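(* Let $k$ be an infinite field and $R=k[x_1,\dots,x_r]$ the standard graded polynomial ring. Suppose that $h=(1,h_1=r,h_2,\dots,h_{e-2},h_{e-1}=r,h_e=1)$ is the $h$-vector of an artinian Gorenstein graded algebra $R/I$ (with $I$ a homogeneous ideal). Let $i$ be an integer with $1\le i\le \frac{e}{2}-1$. Then \[ h_{i+1}\;\ge\;\left(\left(h_i\right)_{(e-i)}\right)^{-1}_{-1}+\left(\left(h_i\right)_{(e-i)}\right)^{-(e-2i)}_{-(e-2i-1)}. \]
   Context: The $h$-vector of a standard graded artinian algebra $A=\bigoplus_{d\ge0}A_d$ is its Hilbert function $h_d=\dim_k A_d$, listed as $(h_0,h_1,\dots,h_e)$ where $e$ (the socle degree) is the largest degree with $h_e\neq 0$. For positive integers $n,d$, the $d$-binomial expansion of $n$ is the unique expression $n_{(d)}=\binom{n_d}{d}+\binom{n_{d-1}}{d-1}+\dots+\binom{n_j}{j}$ with $n_d>n_{d-1}>\dots>n_j\ge j\ge1$. For integers $a,b$ one sets $\left(n_{(d)}\right)^{b}_{a}=\binom{n_d+b}{d+a}+\binom{n_{d-1}+b}{d-1+a}+\dots+\binom{n_j+b}{j+a}$, with the convention $\binom{m}{q}=0$ whenever $m<q$ or $q<0$. *)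

theory Defs
  imports Main "HOL.Vector_Spaces" "HOL-Library.Poly_Mapping"
begin

type_synonym 'a mpoly = "(nat \<Rightarrow>\<^sub>0 nat) \<Rightarrow>\<^sub>0 'a"

definition mdeg :: "(nat \<Rightarrow>\<^sub>0 nat) \<Rightarrow> nat" where
  "mdeg m = (\<Sum>j\<in>Poly_Mapping.keys m. Poly_Mapping.lookup m j)"

definition polys :: "nat \<Rightarrow> 'a::zero mpoly set" where
  "polys r = {p. \<forall>m\<in>Poly_Mapping.keys p. Poly_Mapping.keys m \<subseteq> {..<r}}"

definition var :: "nat \<Rightarrow> 'a::{zero,one} mpoly" where
  "var j = Poly_Mapping.single (Poly_Mapping.single j 1) 1"

definition smult :: "'a::comm_ring_1 \<Rightarrow> 'a mpoly \<Rightarrow> 'a mpoly" where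
  "smult c p = Poly_Mapping.single 0 c * p"

definition homog :: "nat \<Rightarrow> 'a::zero mpoly \<Rightarrow> bool" where
  "homog d p \<longleftrightarrow> (\<forall>m\<in>Poly_Mapping.keys p. mdeg m = d)"

definition hcomp :: "nat \<Rightarrow> 'a::zero mpoly \<Rightarrow> 'a mpoly" where
  "hcomp d p = Abs_poly_mapping (\<lambda>m. if mdeg m = d then Poly_Mapping.lookup p m else 0)"

definition graded_part :: "nat \<Rightarrow> 'a::zero mpoly set \<Rightarrow> nat \<Rightarrow> 'a mpoly set" where
  "graded_part r S d = {p \<in> S \<inter> polys r. homog d p}"

definition ideal_in :: "nat \<Rightarrow> 'a::comm_ring_1 mpoly set \<Rightarrow> bool" where
  "ideal_in r I \<longleftrightarrow> I \<subseteq> polys r \<and> 0 \<in> I \<and> (\<forall>p\<in>I. \<forall>q\<in>I. p + q \<in> I)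
     \<and> (\<forall>f\<in>polys r. \<forall>p\<in>I. f * p \<in> I)"

definition homogeneous_ideal :: "nat \<Rightarrow> 'a::comm_ring_1 mpoly set \<Rightarrow> bool" where
  "homogeneous_ideal r I \<longleftrightarrow> ideal_in r I \<and> (\<forall>p\<in>I. \<forall>d. hcomp d p \<in> I)"

definition kdim :: "'a::field mpoly set \<Rightarrow> nat" where
  "kdim V = vector_space.dim smult V"

text \<open>Hilbert function of R/I: h_d = dim_k R_d - dim_k I_d = dim_k (R/I)_d.\<close>
definition hilb :: "nat \<Rightarrow> 'a::field mpoly set \<Rightarrow> nat \<Rightarrow> nat" where
  "hilb r I d = kdim (graded_part r (UNIV :: 'a mpoly set) d) - kdim (graded_part r I d)"

definition socle_dim :: "nat \<Rightarrow> 'a::field mpoly set \<Rightarrow> nat \<Rightarrow> nat" where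
  "socle_dim r I d =
     kdim {f \<in> graded_part r (UNIV :: 'a mpoly set) d. \<forall>j<r. var j * f \<in> I} - kdim (graded_part r I d)"

definition artinian :: "nat \<Rightarrow> 'a::field mpoly set \<Rightarrow> bool" where
  "artinian r I \<longleftrightarrow> (\<exists>N. \<forall>d\<ge>N. hilb r I d = 0)"

definition artinian_gorenstein :: "nat \<Rightarrow> 'a::field mpoly set \<Rightarrow> bool" where
  "artinian_gorenstein r I \<longleftrightarrow>
     (\<exists>N. (\<forall>d\<ge>N. hilb r I d = 0) \<and> (\<Sum>d<N. socle_dim r I d) = 1)"

text \<open>A list [n_d, n_{d-1}, ..., n_j] is the d-binomial expansion of n.\<close>
definition is_macaulay_rep :: "nat \<Rightarrow> nat \<Rightarrow> nat list \<Rightarrow> bool" where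
  "is_macaulay_rep n d as \<longleftrightarrow>
     length as \<le> d \<and> sorted_wrt (>) as
     \<and> (as \<noteq> [] \<longrightarrow> last as \<ge> d + 1 - length as \<and> d + 1 - length as \<ge> 1)
     \<and> n = (\<Sum>t<length as. (as ! t) choose (d - t))"

definition macaulay_rep :: "nat \<Rightarrow> nat \<Rightarrow> nat list" where
  "macaulay_rep n d = (THE as. is_macaulay_rep n d as)"

definition ibinom :: "int \<Rightarrow> int \<Rightarrow> int" where
  "ibinom m q = (if m < q \<or> q < 0 then 0 else int (nat m choose nat q))"

definition macaulay_shift :: "nat \<Rightarrow> nat \<Rightarrow> int \<Rightarrow> int \<Rightarrow> int" where
  "macaulay_shift n d a b =
     (let as = macaulay_rep n d in
      \<Sum>t<length as. ibinom (int (as ! t) + b) (int (d - t) + a))"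

end

theory Submission
  imports Defs
begin

text \<open>
  Let \<open>A = R/I\<close> and let \<open>L\<close> be a linear form that satisfies Green's restriction bound in degree
  \<open>e - i\<close>. Put \<open>c d = dim (A/LA)\<^sub>d\<close> and let \<open>b d\<close> be the rank of multiplication by \<open>L\<close> from \<open>A\<^sub>d\<close>
  to \<open>A\<^sub>d\<^sub>+\<^sub>1\<close>, so that \<open>h (d + 1) = b d + c (d + 1)\<close>. The perfect pairing
  \<open>A\<^sub>d \<times> A\<^sub>e\<^sub>-\<^sub>d \<rightarrow> A\<^sub>e\<close> gives \<open>h i = h (e - i)\<close> and \<open>b i = b (e - i - 1)\<close>. Hence
  \<open>h (i + 1) = (h i - y) + c (i + 1)\<close> with \<open>y = c (e - i)\<close>, where \<open>y\<close> is at most Green's number of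
  \<open>h i\<close>, and Macaulay's theorem bounds \<open>c (i + 1)\<close> below in terms of \<open>y\<close>. This lower bound is monotone and
  1-Lipschitz in \<open>y\<close>, so the worst case is equality in Green's bound, which is the assertion.
  Green's theorem needs no ideal: it holds for every subspace \<open>V\<close> of \<open>R\<^sub>d\<close>, by induction on \<open>d\<close> and on the
  codimension of \<open>V\<close>. Macaulay's theorem follows, since \<open>V : L\<close> contains every subspace that \<open>R\<^sub>1\<close>
  multiplies into \<open>V\<close>.
\<close>

section \<open>Green's and Macaulay's numerical functions\<close>

text \<open>The leading entry of the \<open>d\<close>-binomial expansion of \<open>n\<close>, found
  greedily.\<close>

definition cascade_top :: "nat \<Rightarrow> nat \<Rightarrow> nat" where
  "cascade_top d n = (GREATEST m. m choose d \<le> n)"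

lemma cascade_top_eqI:
  assumes "m choose d \<le> n" "n < Suc m choose d"
  shows "cascade_top d n = m"
  unfolding cascade_top_def
proof (rule Greatest_equality)
  fix k assume "k choose d \<le> n"
  then show "k \<le> m"
    using assms(2) binomial_right_mono[of "Suc m" k d] by (meson le_trans not_less not_less_eq_eq leD)
qed (rule assms(1))

lemma cascade_top_exists:
  assumes "0 < d" "0 < n"
  obtains m where "d \<le> m" "m choose d \<le> n" "n < Suc m choose d"
proof -
  have "\<exists>k. n < k choose d"
  proof -
    have "n < (d + n) choose d"
    proof (induction n)
      case (Suc n)
      have "0 < (d + n) choose (d - 1)"
        by simp
      moreover have "(d + Suc n) choose d = ((d + n) choose (d - 1)) + ((d + n) choose d)"
        using assms(1) by (cases d) auto
      ultimately show ?case
        using Suc by linarith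
    qed simp
    then show ?thesis by blast
  qed
  define k where "k = (LEAST k. n < k choose d)"
  have k: "n < k choose d"
    unfolding k_def by (rule LeastI_ex) fact
  have least: "\<not> n < j choose d" if "j < k" for j
    using that not_less_Least unfolding k_def by blast
  have "d < k"
    using k assms(2) by (metis binomial_eq_0_iff binomial_n_n less_one linorder_neqE_nat not_less0 not_less_iff_gr_or_eq)
  then obtain m where m: "k = Suc m"
    by (cases k) auto
  show thesis
    using that[of m] \<open>d < k\<close> k least[of m] m by auto
qed

text \<open>For \<open>d \<ge> 1\<close>, \<open>green d n\<close> is \<open>(n\<^sub>(\<^sub>d\<^sub>))\<close> with upper shift \<open>-1\<close> and lower shift \<open>0\<close>; below, \<open>macaulay_down d n\<close>
  has both shifts equal to \<open>-1\<close>. The value \<open>green 0 n = n\<close> is a convention that lets inductions start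
  in degree \<open>0\<close>.\<close>
fun green :: "nat \<Rightarrow> nat \<Rightarrow> nat" where
  "green 0 n = n"
| "green (Suc d) n =
    (if n = 0 then 0
     else let m = cascade_top (Suc d) n
          in ((m - 1) choose Suc d) + green d (n - (m choose Suc d)))"

lemma green_zero [simp]: "green d 0 = 0"
  by (cases d) auto

text \<open>The boundary case \<open>n = m choose d\<close>, where the leading binomial coefficient of the sum
  changes, is what makes the inductive proofs below work.\<close>
lemma green_cascade:
  assumes "d < m" "n \<le> m choose d"
  shows "green (Suc d) ((m choose Suc d) + n) = ((m - 1) choose Suc d) + green d n"
  using assms
proof (induction d arbitrary: m n)
  case 0
  have "cascade_top (Suc 0) (m + n) = m + n"
    by (rule cascade_top_eqI) auto
  then show ?case
    using 0 by auto
next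
  case (Suc d)
  have pos: "0 < m choose Suc (Suc d)"
    using Suc.prems by simp
  show ?case
  proof (cases "n = m choose Suc d")
    case False
    then have "cascade_top (Suc (Suc d)) ((m choose Suc (Suc d)) + n) = m"
      using Suc.prems by (intro cascade_top_eqI) auto
    then show ?thesis
      using pos by simp
  next
    case True
    \<comment> \<open>By Pascal the argument is exactly \<open>Suc m choose Suc (Suc d)\<close>, so
      the leading entry jumps to \<open>Suc m\<close> and the remainder is 0.\<close>
    have "cascade_top (Suc (Suc d)) ((m choose Suc (Suc d)) + n) = Suc m"
      using True Suc.prems by (intro cascade_top_eqI) auto
    then have 1: "green (Suc (Suc d)) ((m choose Suc (Suc d)) + n) = m choose Suc (Suc d)"
      using pos True by simp
    have 2: "green (Suc d) n = (m - 1) choose Suc d"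
      using Suc.IH[of m 0] Suc.prems True by simp
    obtain m' where "m = Suc m'"
      using Suc.prems by (cases m) auto
    then show ?thesis
      using 1 2 by simp
  qed
qed

lemma green_binomial:
  assumes "d \<le> m" "0 < m"
  shows "green d (m choose d) = (m - 1) choose d"
proof (cases d)
  case (Suc d')
  then show ?thesis
    using green_cascade[of d' m 0] assms by simp
qed simp

text \<open>If \<open>n'\<close> is the remainder after the leading term,
  \<open>n' < m choose d\<close> gives \<open>Suc n' \<le> m choose d\<close>. The boundary case of
  \<open>green_cascade\<close> thus lets \<open>n\<close> and \<open>Suc n\<close> share the entry
  \<open>m\<close>, and the claim drops to degree \<open>d\<close>.\<close>

lemma green_step: "green d n \<le> green d (Suc n) \<and> green d (Suc n) \<le> Suc (green d n)"
proof (induction d arbitrary: n)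
  case (Suc d)
  show ?case
  proof (cases "n = 0")
    case True
    have "green (Suc d) 1 = 0"
      using green_binomial[of "Suc d" "Suc d"] by simp
    with True show ?thesis by simp
  next
    case False
    then obtain m where m: "Suc d \<le> m" "m choose Suc d \<le> n" "n < Suc m choose Suc d"
      using cascade_top_exists[of "Suc d" n] by auto
    define n' where "n' = n - (m choose Suc d)"
    have n: "n = (m choose Suc d) + n'" "n' < m choose d"
      using m n'_def by auto
    have "green (Suc d) n = ((m - 1) choose Suc d) + green d n'"
      using green_cascade[of d m n'] m n by auto
    moreover have "green (Suc d) (Suc n) = ((m - 1) choose Suc d) + green d (Suc n')"
      using green_cascade[of d m "Suc n'"] m n by auto
    ultimately show ?thesis
      using Suc.IH[of n'] by auto
  qed
qed auto

lemma green_mono: "n \<le> n' \<Longrightarrow> green d n \<le> green d n'"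
  using green_step lift_Suc_mono_le[of "green d"] by blast

lemma green_le: "green d n \<le> n"
  by (induction n) (use green_step le_Suc_eq le_trans Suc_le_mono in \<open>auto, metis le_trans Suc_le_mono\<close>)

text \<open>By Pascal, \<open>(m choose d) - ((m - 1) choose d)\<close> is
  \<open>(m - 1) choose (d - 1)\<close>, so for \<open>d \<ge> 1\<close> this difference is the sum
  with both shifts \<open>-1\<close>. In this form monotonicity and the Lipschitz bound come from
  \<open>green_step\<close>.\<close>

definition macaulay_down :: "nat \<Rightarrow> nat \<Rightarrow> nat" where
  "macaulay_down d n = n - green d n"

lemma macaulay_down_add_green: "macaulay_down d n + green d n = n"
  using green_le[of d n] by (simp add: macaulay_down_def)

lemma macaulay_down_step:
  "macaulay_down d n \<le> macaulay_down d (Suc n) \<and> macaulay_down d (Suc n) \<le> Suc (macaulay_down d n)"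
  using green_step[of d n] macaulay_down_add_green[of d n] macaulay_down_add_green[of d "Suc n"]
  by linarith

lemma macaulay_down_mono: "n \<le> n' \<Longrightarrow> macaulay_down d n \<le> macaulay_down d n'"
  using macaulay_down_step lift_Suc_mono_le[of "macaulay_down d"] by blast

lemma macaulay_down_lipschitz: "macaulay_down d (n + k) \<le> macaulay_down d n + k"
  by (induction k) (use macaulay_down_step in \<open>auto, metis le_trans Suc_le_mono add_Suc_right\<close>)

text \<open>By monotonicity only \<open>x = (m choose d) - 1\<close> matters. Its leading term is
  \<open>(m - 1) choose d\<close> and its remainder has the same shape one degree lower, down to
  degree 0, where \<open>green\<close> is the identity.\<close>

lemma green_strict:
  assumes "d < m" "x < m choose d"
  shows "green d x < (m - 1) choose d"
proof -
  have "green d ((m choose d) - 1) < (m - 1) choose d"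
    using assms(1)
  proof (induction d arbitrary: m)
    case (Suc d)
    then obtain m' where m': "m = Suc m'" "Suc d \<le> m'"
      by (cases m) auto
    have "0 < m' choose d"
      using m' by simp
    then have "(m choose Suc d) - 1 = (m' choose Suc d) + ((m' choose d) - 1)"
      using m' by (simp del: zero_less_binomial_iff)
    then have "green (Suc d) ((m choose Suc d) - 1) = ((m' - 1) choose Suc d) + green d ((m' choose d) - 1)"
      using green_cascade[of d m' "(m' choose d) - 1"] m' by simp
    also have "\<dots> < ((m' - 1) choose Suc d) + ((m' - 1) choose d)"
      using Suc.IH[of m'] m' by simp
    also have "\<dots> = (m - 1) choose Suc d"
      using m' by (cases m') auto
    finally show ?case .
  qed simp
  moreover have "green d x \<le> green d ((m choose d) - 1)"
    by (rule green_mono) (use assms in simp)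
  ultimately show ?thesis by linarith
qed

text \<open>In Green's argument \<open>c\<close> and \<open>x\<close> are the codimensions of \<open>V + L R\<^sub>d\<close> and of \<open>V : L\<close>, which add up
  to the codimension of \<open>V\<close>.\<close>
lemma green_superadditive:
  assumes "c \<le> green (Suc d) c + green d x"
  shows "c \<le> green (Suc d) (c + x)"
  using assms
proof (induction d arbitrary: c x)
  case 0
  have g1: "green (Suc 0) n = n - 1" for n
    using green_cascade[of 0 n 0] by (cases "n = 0") auto
  show ?case
    using 0 unfolding g1 by (cases c) auto
next
  case (Suc d)
  show ?case
  proof (cases "c = 0")
    case False
    then obtain m where m: "Suc (Suc d) \<le> m" "m choose Suc (Suc d) \<le> c" "c < Suc m choose Suc (Suc d)"
      using cascade_top_exists[of "Suc (Suc d)" c] by auto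
    define c' where "c' = c - (m choose Suc (Suc d))"
    have c: "c = (m choose Suc (Suc d)) + c'" "c' < m choose Suc d"
      using m c'_def by auto
    obtain m' where m': "m = Suc m'"
      using m by (cases m) auto
    have "green (Suc (Suc d)) c = ((m - 1) choose Suc (Suc d)) + green (Suc d) c'"
      using green_cascade[of "Suc d" m c'] c m by simp
    then have hyp: "((m - 1) choose Suc d) + c' \<le> green (Suc d) c' + green (Suc d) x"
      using Suc.prems c m' by simp
    \<comment> \<open>Otherwise \<open>green_strict\<close> makes Green's number of \<open>x\<close>
      too small for \<open>hyp\<close>.\<close>
    have "m choose Suc d \<le> x"
    proof (rule ccontr)
      assume "\<not> ?thesis"
      then have "green (Suc d) x < (m - 1) choose Suc d"
        using m by (intro green_strict) auto
      with hyp green_le[of "Suc d" c'] show False by linarith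
    qed
    then obtain x' where x: "x = (m choose Suc d) + x'"
      using le_Suc_ex by blast
    \<comment> \<open>The cap keeps the remainder within the range of \<open>green_cascade\<close>;
      \<open>y\<close> below is capped for the same reason.\<close>
    define x'' where "x'' = min x' (m choose d)"
    have "green (Suc d) ((m choose Suc d) + x'') = ((m - 1) choose Suc d) + green d x''"
      using m by (intro green_cascade) (auto simp: x''_def)
    have "c' \<le> green (Suc d) c' + green d x''"
    proof (cases "x' \<le> m choose d")
      case True
      then have "x'' = x'"
        by (simp add: x''_def)
      then show ?thesis
        using hyp green_cascade[of d m x'] True m x by simp
    next
      case False
      then have "green d x'' = (m - 1) choose d"
        using green_binomial[of d m] m by (simp add: x''_def)
      \<comment> \<open>The goal now amounts to
        \<open>macaulay_down (Suc d) c' \<le> (m - 1) choose d\<close>, and monotonicity reduces it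
        to the value at \<open>m choose Suc d\<close>.\<close>
      moreover have "macaulay_down (Suc d) c' \<le> macaulay_down (Suc d) (m choose Suc d)"
        using c by (intro macaulay_down_mono) simp
      moreover have "macaulay_down (Suc d) (m choose Suc d) = (m - 1) choose d"
        using green_binomial[of "Suc d" m] m m' by (simp add: macaulay_down_def)
      ultimately show ?thesis
        using macaulay_down_add_green[of "Suc d" c'] by linarith
    qed
    then have IH: "c' \<le> green (Suc d) (c' + x'')"
      by (rule Suc.IH)
    define y where "y = min (c' + x') (Suc m choose Suc d)"
    have "c' \<le> green (Suc d) y"
    proof (cases "c' + x' \<le> Suc m choose Suc d")
      case True
      then show ?thesis
        using IH green_mono[of "c' + x''" "c' + x'" "Suc d"] by (simp add: y_def x''_def)
    next
      case False
      then have "green (Suc d) y = m choose Suc d"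
        using green_binomial[of "Suc d" "Suc m"] m by (simp add: y_def)
      then show ?thesis
        using c by simp
    qed
    \<comment> \<open>The leading terms of \<open>c\<close> and \<open>x\<close> add up to
      \<open>Suc m choose Suc (Suc d)\<close>, whose Green number is the leading term of
      \<open>c\<close>; \<open>y\<close> takes care of the rest.\<close>
    then have "c \<le> green (Suc (Suc d)) ((Suc m choose Suc (Suc d)) + y)"
      using green_cascade[of "Suc d" "Suc m" y] m c by (simp add: y_def)
    also have "\<dots> \<le> green (Suc (Suc d)) (c + x)"
      using c x by (intro green_mono) (auto simp: y_def)
    finally show ?thesis .
  qed simp
qed

section \<open>Binomial expansions\<close>

fun cascade :: "nat \<Rightarrow> nat list \<Rightarrow> bool" where
  "cascade d [] \<longleftrightarrow> True"
| "cascade d (m # ms) \<longleftrightarrow> 0 < d \<and> d \<le> m \<and> (ms \<noteq> [] \<longrightarrow> hd ms < m) \<and> cascade (d - 1) ms"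

fun cascade_sum :: "int \<Rightarrow> int \<Rightarrow> nat \<Rightarrow> nat list \<Rightarrow> int" where
  "cascade_sum a b d [] = 0"
| "cascade_sum a b d (m # ms) = ibinom (int m + b) (int d + a) + cascade_sum a b (d - 1) ms"

fun cascade_val :: "nat \<Rightarrow> nat list \<Rightarrow> nat" where
  "cascade_val d [] = 0"
| "cascade_val d (m # ms) = (m choose d) + cascade_val (d - 1) ms"

lemma ibinom_of_nat: "ibinom (int m) (int d) = int (m choose d)"
  by (simp add: ibinom_def binomial_eq_0)

lemma int_cascade_val: "int (cascade_val d ms) = cascade_sum 0 0 d ms"
  by (induction d ms rule: cascade_val.induct) (simp_all add: ibinom_of_nat)

lemma cascade_sum_conv_sum:
  "cascade_sum a b d ms = (\<Sum>t<length ms. ibinom (int (ms ! t) + b) (int (d - t) + a))"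
proof (induction ms arbitrary: d)
  case (Cons m ms)
  have "int (d - Suc t) = int (d - 1 - t)" for t
    by simp
  then show ?case
    by (simp add: Cons.IH sum.lessThan_Suc_shift del: sum.lessThan_Suc)
qed simp

text \<open>The definition asks only the last entry to be at least its degree. Entries strictly
  decrease while degrees drop by exactly one, so the bound propagates to every entry.\<close>

lemma is_macaulay_rep_iff: "is_macaulay_rep n d ms \<longleftrightarrow> cascade d ms \<and> n = cascade_val d ms"
proof -
  have val: "(\<Sum>t<length ms. (ms ! t) choose (d - t)) = cascade_val d ms"
    using cascade_sum_conv_sum[of 0 0 d ms] int_cascade_val[of d ms]
    by (simp add: ibinom_of_nat flip: of_nat_sum)
  have cas: "cascade d ms \<longleftrightarrow> length ms \<le> d \<and> sorted_wrt (>) ms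
      \<and> (ms \<noteq> [] \<longrightarrow> last ms \<ge> d + 1 - length ms \<and> d + 1 - length ms \<ge> 1)"
  proof (induction d ms rule: cascade.induct)
    case (2 d m ms)
    show ?case
    proof (cases ms)
      case Nil
      then show ?thesis by (cases d) auto
    next
      case (Cons m' ms')
      have sorted: "sorted_wrt (>) (m # ms) \<longleftrightarrow> m' < m \<and> sorted_wrt (>) ms"
        using Cons by auto
      have last: "last (m # ms) = last ms" and "ms \<noteq> []"
        using Cons by auto
      show ?thesis
      proof (cases "0 < d")
        case True
        then have eq: "d - 1 + 1 - length ms = d + 1 - length (m # ms)"
            "length (m # ms) \<le> d \<longleftrightarrow> length ms \<le> d - 1"
          by auto
        have "d \<le> m" if "cascade (d - 1) ms" "m' < m"
        proof -
          have "d - 1 \<le> m'"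
            using that Cons by simp
          with that show ?thesis by linarith
        qed
        moreover have "cascade d (m # ms) \<longleftrightarrow> d \<le> m \<and> m' < m \<and> cascade (d - 1) ms"
          using True Cons by simp
        ultimately show ?thesis
          unfolding sorted last using "2.IH" \<open>ms \<noteq> []\<close> unfolding eq by blast
      qed simp
    qed
  qed simp
  show ?thesis
    unfolding is_macaulay_rep_def cas val by auto
qed

section \<open>Existence and uniqueness of binomial expansions\<close>

lemma cascade_val_less:
  assumes "cascade d ms" "ms \<noteq> [] \<longrightarrow> hd ms < m" "d \<le> m"
  shows "cascade_val d ms < m choose d"
  using assms
proof (induction d ms arbitrary: m rule: cascade.induct)
  case (2 d k ms)
  then obtain d' where d: "d = Suc d'"
    by (cases d) auto
  have "cascade_val d' ms < k choose d'"
    using 2 d by simp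
  then have "cascade_val d (k # ms) < Suc k choose d"
    using d by simp
  also have "\<dots> \<le> m choose d"
    using 2 by (intro binomial_right_mono) auto
  finally show ?case .
qed simp

text \<open>By \<open>cascade_val_less\<close> the tail is too small to reach the next binomial, so
  the greedy choice recovers the head; uniqueness of expansions follows by induction.\<close>

lemma cascade_top_cascade_val:
  assumes "cascade d (m # ms)"
  shows "cascade_top d (cascade_val d (m # ms)) = m"
proof -
  obtain d' where d: "d = Suc d'"
    using assms by (cases d) auto
  have "cascade_val d' ms < m choose d'"
    using assms d by (intro cascade_val_less) auto
  then show ?thesis
    using d by (intro cascade_top_eqI) auto
qed

lemma cascade_inj:
  assumes "cascade d ms" "cascade d ks" "cascade_val d ms = cascade_val d ks"
  shows "ms = ks"
  using assms
proof (induction d ms arbitrary: ks rule: cascade.induct)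
  case (1 d)
  then show ?case
    by (cases ks) auto
next
  case (2 d m ms)
  then obtain k ks' where ks: "ks = k # ks'"
    by (cases ks) auto
  have "m = k"
    using 2 ks cascade_top_cascade_val by metis
  with 2 ks show ?case by auto
qed

lemma cascade_exists:
  assumes "0 < d"
  shows "\<exists>ms. cascade d ms \<and> cascade_val d ms = n"
  using assms
proof (induction d arbitrary: n)
  case (Suc d)
  show ?case
  proof (cases "n = 0")
    case True
    then show ?thesis
      by (intro exI[of _ "[]"]) simp
  next
    case False
    then obtain m where m: "Suc d \<le> m" "m choose Suc d \<le> n" "n < Suc m choose Suc d"
      using cascade_top_exists[of "Suc d" n] by auto
    define n' where "n' = n - (m choose Suc d)"
    have n': "n = (m choose Suc d) + n'" "n' < m choose d"
      using m n'_def by auto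
    have "\<exists>ms. cascade d ms \<and> cascade_val d ms = n'"
    proof (cases "d = 0")
      \<comment> \<open>In degree 0 the remainder is below \<open>m choose 0 = 1\<close>, so it is 0
        and the expansion stops.\<close>
      case True
      then show ?thesis
        using n' by (intro exI[of _ "[]"]) simp
    qed (use Suc in auto)
    then obtain ms where ms: "cascade d ms" "cascade_val d ms = n'"
      by blast
    have "hd ms < m" if "ms \<noteq> []"
    proof (rule ccontr)
      assume "\<not> hd ms < m"
      then have "m choose d \<le> hd ms choose d"
        by (intro binomial_right_mono) simp
      also have "\<dots> \<le> cascade_val d ms"
        using that by (cases ms) auto
      finally show False
        using n' ms by simp
    qed
    then show ?thesis
      using ms m n' by (intro exI[of _ "m # ms"]) auto
  qed
qed simp

lemma macaulay_rep_cascade: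
  assumes "0 < d"
  shows "cascade d (macaulay_rep n d)" "cascade_val d (macaulay_rep n d) = n"
proof -
  obtain ms where "cascade d ms" "cascade_val d ms = n"
    using cascade_exists[OF assms] by blast
  then have "\<exists>!ms. is_macaulay_rep n d ms"
    unfolding is_macaulay_rep_iff using cascade_inj by blast
  then have "is_macaulay_rep n d (macaulay_rep n d)"
    unfolding macaulay_rep_def by (rule theI')
  then show "cascade d (macaulay_rep n d)" "cascade_val d (macaulay_rep n d) = n"
    by (simp_all add: is_macaulay_rep_iff)
qed

lemma macaulay_shift_conv_cascade_sum:
  "macaulay_shift n d a b = cascade_sum a b d (macaulay_rep n d)"
  by (simp add: macaulay_shift_def cascade_sum_conv_sum Let_def)

lemma macaulay_down_cascade:
  assumes "cascade d ms"
  shows "int (macaulay_down d (cascade_val d ms)) = cascade_sum (- 1) (- 1) d ms"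
  using assms
proof (induction d ms rule: cascade.induct)
  case (1 d)
  then show ?case
    by (simp add: macaulay_down_def)
next
  case (2 d m ms)
  then obtain d' m' where d: "d = Suc d'" "m = Suc m'"
    by (cases d; cases m) auto
  have "cascade_val d' ms < m choose d'"
    using 2 d by (intro cascade_val_less) auto
  then have "green d (cascade_val d (m # ms)) = (m' choose d) + green d' (cascade_val d' ms)"
    using green_cascade[of d' m "cascade_val d' ms"] 2 d by simp
  moreover have "int (macaulay_down d' (cascade_val d' ms)) = cascade_sum (- 1) (- 1) d' ms"
    using 2 d by simp
  ultimately have "int (macaulay_down d (cascade_val d (m # ms)))
      = int (m' choose d') + cascade_sum (- 1) (- 1) d' ms"
    using macaulay_down_add_green[of d "cascade_val d (m # ms)"]
      macaulay_down_add_green[of d' "cascade_val d' ms"] d by simp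
  then show ?case
    using d by (simp add: ibinom_of_nat)
qed

text \<open>\<open>macaulay_iter d s n\<close> bounds from below a Hilbert function in degree \<open>d - s\<close>
  whose value in degree \<open>d\<close> is \<open>n\<close>.\<close>
fun macaulay_iter :: "nat \<Rightarrow> nat \<Rightarrow> nat \<Rightarrow> nat" where
  "macaulay_iter d 0 n = n"
| "macaulay_iter d (Suc s) n = macaulay_iter (d - 1) s (macaulay_down d n)"

lemma macaulay_iter_mono: "n \<le> n' \<Longrightarrow> macaulay_iter d s n \<le> macaulay_iter d s n'"
  by (induction s arbitrary: d n n') (simp_all add: macaulay_down_mono)

lemma macaulay_iter_lipschitz: "macaulay_iter d s (n + k) \<le> macaulay_iter d s n + k"
proof (induction s arbitrary: d n k)
  case (Suc s)
  have "macaulay_iter (d - 1) s (macaulay_down d (n + k))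
      \<le> macaulay_iter (d - 1) s (macaulay_down d n + k)"
    by (intro macaulay_iter_mono macaulay_down_lipschitz)
  also have "\<dots> \<le> macaulay_iter (d - 1) s (macaulay_down d n) + k"
    by (rule Suc.IH)
  finally show ?case by simp
qed simp

text \<open>The bottom term of the cascade is dropped because lowering it may yield a constant
  \<open>1 = m choose 0\<close>, which no longer fits into a cascade of degree \<open>d - 1\<close>.\<close>
fun cascade_lower :: "nat \<Rightarrow> nat list \<Rightarrow> nat list" where
  "cascade_lower d [] = []"
| "cascade_lower d (m # ms) = (if d \<le> 1 then [] else (m - 1) # cascade_lower (d - 1) ms)"

lemma ibinom_nonneg: "0 \<le> ibinom m q"
  by (simp add: ibinom_def)

lemma cascade_cascade_lower: "cascade d ms \<Longrightarrow> cascade (d - 1) (cascade_lower d ms)"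
proof (induction d ms rule: cascade.induct)
  case (2 d m ms)
  show ?case
  proof (cases "d \<le> 1 \<or> ms = []")
    case False
    then obtain k ks where ms: "ms = k # ks"
      by (cases ms) auto
    then have "0 < d - 1" "d - 1 \<le> k" "k < m" "\<not> d \<le> 1"
      using 2 False by auto
    moreover have "cascade (d - 1 - 1) (cascade_lower (d - 1) ms)"
      using 2 by simp
    ultimately show ?thesis
      using ms by auto
  qed (use 2 in auto)
qed simp

text \<open>The two sides differ only by a dropped term of degree 1, whose lower index becomes
  \<open>- int s\<close>. It contributes 1 for \<open>s = 0\<close> and vanishes for
  \<open>s > 0\<close>.\<close>

lemma cascade_sum_cascade_lower:
  assumes "cascade d ms"
  shows "cascade_sum (- int s) (- int s) (d - 1) (cascade_lower d ms)
           \<le> cascade_sum (- int (Suc s)) (- int (Suc s)) d ms"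
    and "0 < s \<Longrightarrow> cascade_sum (- int s) (- int s) (d - 1) (cascade_lower d ms)
           = cascade_sum (- int (Suc s)) (- int (Suc s)) d ms"
proof -
  have "cascade_sum (- int s) (- int s) (d - 1) (cascade_lower d ms)
           \<le> cascade_sum (- int (Suc s)) (- int (Suc s)) d ms \<and>
        (0 < s \<longrightarrow> cascade_sum (- int s) (- int s) (d - 1) (cascade_lower d ms)
           = cascade_sum (- int (Suc s)) (- int (Suc s)) d ms)"
    using assms
  proof (induction d ms rule: cascade.induct)
    case (2 d m ms)
    show ?case
    proof (cases "d = 1")
      case True
      then have "ms = []"
        using 2 by (cases ms) auto
      with True show ?thesis
        by (auto simp: ibinom_nonneg ibinom_def)
    next
      case False
      then have "1 < d" "0 < m"
        using 2 by auto
      then have eq: "int (m - 1) + (- int s) = int m + (- int (Suc s))"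
          "int (d - 1) + (- int s) = int d + (- int (Suc s))"
        by linarith+
      have "cascade (d - 1) ms"
        using 2 by simp
      with "2.IH" have "cascade_sum (- int s) (- int s) (d - 1 - 1) (cascade_lower (d - 1) ms)
           \<le> cascade_sum (- int (Suc s)) (- int (Suc s)) (d - 1) ms \<and>
        (0 < s \<longrightarrow> cascade_sum (- int s) (- int s) (d - 1 - 1) (cascade_lower (d - 1) ms)
           = cascade_sum (- int (Suc s)) (- int (Suc s)) (d - 1) ms)"
        using "2.prems" by blast
      moreover have "cascade_lower d (m # ms) = (m - 1) # cascade_lower (d - 1) ms"
        using \<open>1 < d\<close> by simp
      ultimately show ?thesis
        unfolding cascade_sum.simps eq by (simp only: cascade_sum.simps eq) linarith
    qed
  qed simp
  then show "cascade_sum (- int s) (- int s) (d - 1) (cascade_lower d ms)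
           \<le> cascade_sum (- int (Suc s)) (- int (Suc s)) d ms"
    and "0 < s \<Longrightarrow> cascade_sum (- int s) (- int s) (d - 1) (cascade_lower d ms)
           = cascade_sum (- int (Suc s)) (- int (Suc s)) d ms"
    by blast+
qed

lemma macaulay_iter_cascade:
  assumes "cascade d ms"
  shows "cascade_sum (- int s) (- int s) d ms \<le> int (macaulay_iter d s (cascade_val d ms))"
  using assms
proof (induction s arbitrary: d ms)
  case 0
  then show ?case
    by (simp add: int_cascade_val)
next
  case (Suc s)
  note lower = cascade_sum_cascade_lower[OF Suc.prems]
  show ?case
  \<comment> \<open>A single step is evaluated exactly. With more steps to come, the dropped bottom
    term contributes nothing to the target, so \<open>cascade_lower\<close> may be used.\<close>
  proof (cases "s = 0")
    case True
    then show ?thesis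
      using macaulay_down_cascade[OF Suc.prems] by simp
  next
    case False
    have "int (cascade_val (d - 1) (cascade_lower d ms)) \<le> int (macaulay_down d (cascade_val d ms))"
      using lower(1)[of 0] macaulay_down_cascade[OF Suc.prems] by (simp add: int_cascade_val)
    then have "macaulay_iter (d - 1) s (cascade_val (d - 1) (cascade_lower d ms))
        \<le> macaulay_iter (d - 1) s (macaulay_down d (cascade_val d ms))"
      by (intro macaulay_iter_mono) simp
    moreover have "cascade_sum (- int s) (- int s) (d - 1) (cascade_lower d ms)
        \<le> int (macaulay_iter (d - 1) s (cascade_val (d - 1) (cascade_lower d ms)))"
      by (intro Suc.IH cascade_cascade_lower Suc.prems)
    ultimately show ?thesis
      using lower(2)[of s] False by simp
  qed
qed

text \<open>Once \<open>m = d\<close> occurs, all later binomials \<open>(m - 1) choose d\<close> vanish.\<close>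
fun cascade_green :: "nat \<Rightarrow> nat list \<Rightarrow> nat list" where
  "cascade_green d [] = []"
| "cascade_green d (m # ms) = (if d < m then (m - 1) # cascade_green (d - 1) ms else [])"

lemma cascade_cascade_green: "cascade d ms \<Longrightarrow> cascade d (cascade_green d ms)"
proof (induction d ms rule: cascade.induct)
  case (2 d m ms)
  show ?case
  proof (cases ms)
    case (Cons k ks)
    then have "d - 1 \<le> k" "k < m" "cascade (d - 1) (cascade_green (d - 1) ms)"
      using 2 by auto
    then show ?thesis
      using 2 Cons by auto
  qed (use 2 in auto)
qed simp

text \<open>The hypotheses force the leading entry to equal its degree, and then all later ones too;
  every upper index thus falls one short of its lower index.\<close>

lemma cascade_sum_eq_0:
  assumes "cascade d ms" "ms \<noteq> [] \<longrightarrow> hd ms \<le> d"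
  shows "cascade_sum (- int s) (- int (Suc s)) d ms = 0"
  using assms
proof (induction d ms rule: cascade.induct)
  case (2 d m ms)
  have "cascade_sum (- int s) (- int (Suc s)) (d - 1) ms = 0"
    using 2 by (intro "2.IH") auto
  then show ?case
    using 2 by (simp add: ibinom_def)
qed simp

lemma cascade_sum_cascade_green:
  "cascade d ms \<Longrightarrow> cascade_sum (- int s) (- int s) d (cascade_green d ms)
     = cascade_sum (- int s) (- int (Suc s)) d ms"
proof (induction d ms rule: cascade.induct)
  case (2 d m ms)
  show ?case
  proof (cases "d < m")
    case True
    then have eq: "int (m - 1) + (- int s) = int m + (- int (Suc s))"
      by linarith
    have "cascade (d - 1) ms"
      using 2 by simp
    then have IH: "cascade_sum (- int s) (- int s) (d - 1) (cascade_green (d - 1) ms)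
        = cascade_sum (- int s) (- int (Suc s)) (d - 1) ms"
      using "2.IH" True by blast
    show ?thesis
      using True by (simp only: cascade_green.simps cascade_sum.simps if_True eq IH)
  next
    case False
    then show ?thesis
      using cascade_sum_eq_0[of d "m # ms" s] 2 by auto
  qed
qed simp

lemma cascade_sum_pascal:
  "cascade d ms \<Longrightarrow> cascade_sum 0 0 d ms = cascade_sum (- 1) (- 1) d ms + cascade_sum 0 (- 1) d ms"
proof (induction d ms rule: cascade.induct)
  case (2 d m ms)
  then obtain d' m' where "d = Suc d'" "m = Suc m'"
    by (cases d; cases m) auto
  moreover have "ibinom (int m') (1 + int d') = int (m' choose Suc d')"
    using ibinom_of_nat[of m' "Suc d'"] by simp
  moreover have "ibinom (1 + int m') (1 + int d') = int (Suc m' choose Suc d')"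
    using ibinom_of_nat[of "Suc m'" "Suc d'"] by simp
  ultimately show ?case
    using 2 by (simp add: ibinom_of_nat)
qed simp

text \<open>By subtraction: Pascal splits the value into the sums with shifts
  \<open>(-1, -1)\<close> and \<open>(0, -1)\<close>, and the former is
  \<open>macaulay_down\<close>.\<close>

lemma green_cascade_val:
  assumes "cascade d ms"
  shows "green d (cascade_val d ms) = cascade_val d (cascade_green d ms)"
proof -
  have "int (green d (cascade_val d ms)) = int (cascade_val d (cascade_green d ms))"
    using macaulay_down_cascade[OF assms] macaulay_down_add_green[of d "cascade_val d ms"]
      cascade_sum_pascal[OF assms] cascade_sum_cascade_green[OF assms, of 0, simplified]
    unfolding int_cascade_val[symmetric] by linarith
  then show ?thesis
    by simp
qed

section \<open>Shifted binomial sums against Green's and Macaulay's functions\<close>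

lemma macaulay_shift_macaulay_down:
  "0 < d \<Longrightarrow> macaulay_shift n d (- 1) (- 1) = int (macaulay_down d n)"
  using macaulay_down_cascade[OF macaulay_rep_cascade(1), of d n]
  by (simp add: macaulay_shift_conv_cascade_sum macaulay_rep_cascade)

text \<open>One unit of upper shift is Green's function; the other \<open>s\<close> units of both
  shifts are \<open>s\<close> Macaulay steps. The dropped bottom terms leave an inequality.\<close>

lemma macaulay_shift_le_macaulay_iter:
  assumes "0 < d"
  shows "macaulay_shift n d (- int s) (- int (Suc s)) \<le> int (macaulay_iter d s (green d n))"
proof -
  define ms where "ms = macaulay_rep n d"
  have ms: "cascade d ms" "cascade_val d ms = n"
    using macaulay_rep_cascade[OF assms] by (simp_all add: ms_def)
  have "macaulay_shift n d (- int s) (- int (Suc s))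
      = cascade_sum (- int s) (- int s) d (cascade_green d ms)"
    unfolding macaulay_shift_conv_cascade_sum cascade_sum_cascade_green[OF ms(1)] by (simp add: ms_def)
  also have "\<dots> \<le> int (macaulay_iter d s (cascade_val d (cascade_green d ms)))"
    by (intro macaulay_iter_cascade cascade_cascade_green ms)
  finally show ?thesis
    using green_cascade_val[OF ms(1)] ms(2) by simp
qed

text \<open>Moving \<open>y\<close> down from Green's number by some amount raises
  \<open>n - y\<close> by that amount and lowers the iterate by at most as much.\<close>

lemma macaulay_shift_bound:
  assumes "0 < d" "y \<le> green d n"
  shows "macaulay_shift n d (- 1) (- 1) + macaulay_shift n d (- int s) (- int (Suc s))
           \<le> int (n - y) + int (macaulay_iter d s y)"
proof -
  have "macaulay_iter d s (green d n) \<le> macaulay_iter d s y + (green d n - y)"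
    using macaulay_iter_lipschitz[of d s y "green d n - y"] assms(2) by simp
  then show ?thesis
    using macaulay_shift_macaulay_down[OF assms(1), of n] macaulay_shift_le_macaulay_iter[OF assms(1), of n s]
      macaulay_down_add_green[of d n] assms(2) by linarith
qed

section \<open>Ranks of linear maps and pencils\<close>

context vector_space
begin

text \<open>The polynomial ring is infinite-dimensional, and \<open>dim\<close> is 0 for a space
  with an infinite basis; this predicate restores the usual facts about dimension.\<close>

definition finspan :: "'b set \<Rightarrow> bool" where
  "finspan S \<longleftrightarrow> (\<exists>B. finite B \<and> S \<subseteq> span B)"

lemma finspan_subset: "finspan T \<Longrightarrow> S \<subseteq> T \<Longrightarrow> finspan S"
  unfolding finspan_def by blast

lemma finspan_independent:
  assumes "finspan S" "independent B" "B \<subseteq> S"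
  shows "finite B \<and> card B \<le> dim S"
proof -
  obtain C where C: "finite C" "S \<subseteq> span C"
    using assms(1) unfolding finspan_def by blast
  obtain D where D: "D \<subseteq> S" "independent D" "S \<subseteq> span D" "card D = dim S"
    by (rule basis_exists)
  then have "finite D"
    using independent_span_bound[OF C(1) D(2)] C(2) by blast
  then show ?thesis
    using independent_span_bound[of D B] assms D by auto
qed

lemma finspan_dim_mono:
  assumes "finspan T" "S \<subseteq> T"
  shows "dim S \<le> dim T"
  by (metis assms basis_exists finspan_independent subset_trans)

lemma finspan_subspace_eq:
  assumes "finspan T" "subspace S" "S \<subseteq> T" "dim T \<le> dim S"
  shows "S = T"
proof (rule ccontr)
  assume "S \<noteq> T"
  then obtain x where x: "x \<in> T" "x \<notin> S"
    using assms(3) by blast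
  obtain B where B: "B \<subseteq> S" "independent B" "S \<subseteq> span B" "card B = dim S"
    by (rule basis_exists)
  have "span B \<subseteq> S"
    using B(1) assms(2) by (rule span_minimal)
  then have "x \<notin> span B" "x \<notin> B"
    using x B(1) by auto
  then have "independent (insert x B)" "finite B"
    using B finspan_independent[OF finspan_subset[OF assms(1,3)]] by (simp_all add: independent_insertI)
  then have "Suc (card B) \<le> dim T"
    using finspan_independent[OF assms(1), of "insert x B"] x B(1) assms(3) \<open>x \<notin> B\<close> by auto
  then show False
    using B(4) assms(4) by simp
qed

lemma finspan_union_image:
  assumes "module_hom scale scale f" "finspan V" "finspan X"
  shows "finspan (span (V \<union> f ` X))"
proof -
  interpret f: module_hom scale scale f by fact
  obtain A B where AB: "finite A" "V \<subseteq> span A" "finite B" "X \<subseteq> span B"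
    using assms(2,3) unfolding finspan_def by blast
  then have "f ` X \<subseteq> span (f ` B)"
    using f.span_image by (metis image_mono)
  then have "V \<union> f ` X \<subseteq> span (A \<union> f ` B)"
    using AB span_mono[of A "A \<union> f ` B"] span_mono[of "f ` B" "A \<union> f ` B"] by blast
  then have "span (V \<union> f ` X) \<subseteq> span (A \<union> f ` B)"
    by (rule span_minimal) (rule subspace_span)
  then show ?thesis
    using AB unfolding finspan_def by blast
qed

lemma independent_Un:
  assumes "independent A" "independent B" "finite B" "\<And>x. x \<in> span A \<Longrightarrow> x \<in> span B \<Longrightarrow> x = 0"
  shows "independent (A \<union> B)"
  using assms(3,2,4)
proof (induction B)
  case (insert b B)
  have le: "span B \<subseteq> span (insert b B)"
    by (rule span_mono) blast
  have b: "b \<notin> span B" "independent B"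
    using insert.prems(1) insert.hyps(2) by (simp_all add: independent_insert)
  have "b \<notin> span (A \<union> B)"
  proof
    assume "b \<in> span (A \<union> B)"
    then obtain x y where xy: "b = x + y" "x \<in> span A" "y \<in> span B"
      unfolding span_Un by blast
    then have "x = b - y"
      by simp
    then have "x \<in> span (insert b B)"
      using xy(3) le by (auto intro: span_diff span_base)
    then show False
      using insert.prems(2)[OF xy(2)] xy b by simp
  qed
  moreover have "independent (A \<union> B)"
    using insert.IH b insert.prems(2) le by blast
  ultimately show ?case
    by (simp add: independent_insertI)
qed (use assms(1) in simp)

lemma independent_Un_span_eq_0:
  assumes "independent (A \<union> B)" "finite A" "finite B" "A \<inter> B = {}" "x \<in> span A" "x \<in> span B"
  shows "x = 0"
proof -
  obtain u w where u: "x = (\<Sum>v\<in>A. u v *s v)" and w: "x = (\<Sum>v\<in>B. w v *s v)"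
    using assms span_finite by (metis (no_types, lifting) imageE)
  define g where "g v = (if v \<in> A then u v else - w v)" for v
  have "(\<Sum>v\<in>A \<union> B. g v *s v) = (\<Sum>v\<in>A. g v *s v) + (\<Sum>v\<in>B. g v *s v)"
    using assms by (intro sum.union_disjoint)
  also have "(\<Sum>v\<in>A. g v *s v) = x"
    unfolding u by (intro sum.cong) (auto simp: g_def)
  also have "(\<Sum>v\<in>B. g v *s v) = (\<Sum>v\<in>B. - (w v *s v))"
    using assms(4) by (intro sum.cong) (auto simp: g_def scale_minus_left)
  also have "\<dots> = - x"
    unfolding w by (rule sum_negf)
  finally have "g v = 0" if "v \<in> A" for v
    using assms(1-3) that by (intro independentD[of "A \<union> B" "A \<union> B" g v]) auto
  then show ?thesis
    unfolding u by (simp add: g_def)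
qed

text \<open>A basis of \<open>K\<close> is extended to one of \<open>X\<close>. With
  \<open>K\<close> the kernel of a map modulo \<open>V\<close>, the map becomes injective modulo
  \<open>V\<close> on \<open>span C\<close>.\<close>

lemma complement_exists:
  assumes X: "subspace X" "finspan X" and K: "subspace K" "K \<subseteq> X"
  obtains C where "C \<subseteq> X" "finite C" "independent C" "card C + dim K = dim X"
    "\<And>x. x \<in> span C \<Longrightarrow> x \<in> K \<Longrightarrow> x = 0" "X \<subseteq> span (K \<union> C)"
proof -
  obtain B where B: "B \<subseteq> K" "independent B" "K \<subseteq> span B" "card B = dim K"
    by (rule basis_exists)
  then have "B \<subseteq> X"
    using K by blast
  then obtain B' where B': "B \<subseteq> B'" "B' \<subseteq> X" "independent B'" "X \<subseteq> span B'"
    using maximal_independent_subset_extend B(2) by metis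
  have cardB': "card B' = dim X" "finite B'"
    using B' basis_card_eq_dim finspan_independent[OF X(2)] by auto
  define C where "C = B' - B"
  have un: "B \<union> C = B'" and fin: "finite B" "finite C" and dis: "B \<inter> C = {}"
    using B'(1) cardB' by (auto simp: C_def intro: finite_subset)
  show thesis
  proof
    show "C \<subseteq> X"
      using B' C_def by blast
    show "finite C" by fact
    show "independent C"
      using B'(3) by (rule independent_mono) (auto simp: C_def)
    show "card C + dim K = dim X"
      using cardB' B(4) un fin dis card_Un_disjoint[of B C] by simp
    show "x = 0" if "x \<in> span C" "x \<in> K" for x
      using that B(3) B'(3) un fin dis by (intro independent_Un_span_eq_0[of B C]) auto
    show "X \<subseteq> span (K \<union> C)"
      using B'(4) un B(1) span_mono[of B' "K \<union> C"] by blast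
  qed
qed

text \<open>Rank-nullity for \<open>f\<close> followed by the projection modulo \<open>V\<close>.\<close>
lemma dim_union_image:
  assumes f: "module_hom scale scale f"
    and V: "subspace V" "finspan V" and X: "subspace X" "finspan X"
  shows "dim (span (V \<union> f ` X)) + dim {x \<in> X. f x \<in> V} = dim V + dim X"
proof -
  interpret f: module_hom scale scale f by fact
  define K where "K = {x \<in> X. f x \<in> V}"
  have K: "subspace K" "K \<subseteq> X"
    unfolding K_def using V X by (auto simp: subspace_def f.add f.scale f.zero)
  obtain C where C: "C \<subseteq> X" "finite C" "independent C" "card C + dim K = dim X"
    "\<And>x. x \<in> span C \<Longrightarrow> x \<in> K \<Longrightarrow> x = 0" "X \<subseteq> span (K \<union> C)"
    using complement_exists[OF X K] by metis
  obtain D where D: "D \<subseteq> V" "independent D" "V \<subseteq> span D" "card D = dim V"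
    by (rule basis_exists)
  have finD: "finite D"
    using finspan_independent[OF V(2) D(2,1)] by simp
  have spD: "span D = V"
    using D V(1) by (simp add: span_subspace)
  have spanC: "span C \<subseteq> X"
    using C(1) X(1) by (rule span_minimal)
  have CK: "x = 0" if "x \<in> span C" "f x \<in> V" for x
    using that spanC C(5) K_def by blast
  have inj: "inj_on f (span C)"
  proof (rule inj_onI)
    fix x y assume "x \<in> span C" "y \<in> span C" "f x = f y"
    then have "x - y \<in> span C" "f (x - y) \<in> V"
      using V(1) by (auto simp: f.diff span_diff subspace_0)
    then show "x = y"
      using CK by force
  qed
  have indfC: "independent (f ` C)"
    using C(3) inj by (rule f.independent_injective_image)
  have disj: "v = 0" if "v \<in> span D" "v \<in> span (f ` C)" for v
  proof -
    have "v \<in> f ` span C"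
      using that(2) by (simp add: f.span_image)
    then obtain x where x: "x \<in> span C" "v = f x"
      by blast
    then show ?thesis
      using CK[of x] that(1) spD f.zero by auto
  qed
  have ind: "independent (D \<union> f ` C)"
    using D(2) indfC C(2) disj by (intro independent_Un) auto
  have "D \<inter> f ` C = {}"
  proof (rule ccontr)
    assume "D \<inter> f ` C \<noteq> {}"
    then obtain x where "x \<in> D" "x \<in> f ` C"
      by blast
    then have "x = 0"
      by (intro disj span_base)
    then show False
      using \<open>x \<in> D\<close> D(2) dependent_zero by blast
  qed
  moreover have "card (f ` C) = card C"
    using inj span_superset by (intro card_image) (rule inj_on_subset)
  ultimately have card: "card (D \<union> f ` C) = card D + card C"
    using finD C(2) by (simp add: card_Un_disjoint)
  have "span (D \<union> f ` C) = span (V \<union> f ` X)"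
  proof (rule subset_antisym)
    show "span (D \<union> f ` C) \<subseteq> span (V \<union> f ` X)"
      using D(1) C(1) by (intro span_mono) auto
    have "f x \<in> span (D \<union> f ` C)" if "x \<in> X" for x
    proof -
      have "x \<in> span (K \<union> C)"
        using C(6) that by blast
      moreover have "span K = K"
        using K(1) by simp
      ultimately obtain y z where yz: "x = y + z" "y \<in> K" "z \<in> span C"
        unfolding span_Un by blast
      have "f y \<in> span D"
        using spD yz(2) by (simp add: K_def)
      moreover have "f z \<in> span (f ` C)"
        using yz(3) f.span_image by blast
      ultimately show ?thesis
        unfolding yz(1) f.add span_Un by blast
    qed
    moreover have "V \<subseteq> span (D \<union> f ` C)"
      using spD span_mono[of D "D \<union> f ` C"] by blast
    ultimately show "span (V \<union> f ` X) \<subseteq> span (D \<union> f ` C)"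
      by (intro span_minimal) auto
  qed
  then have "dim (span (V \<union> f ` X)) = card D + card C"
    using ind card by (metis dim_span_eq_card_independent)
  then show ?thesis
    using D C(4) K_def by simp
qed

text \<open>The values \<open>t\<close> at which the rank of a linear pencil drops behave like eigenvalues:
  kernel vectors for distinct such values are linearly independent.\<close>
lemma finite_rank_drop:
  assumes f: "module_hom scale scale f" and g: "module_hom scale scale g"
    and V: "subspace V" "finspan V" and X: "subspace X" "finspan X"
  shows "finite {t. dim (span (V \<union> (\<lambda>x. f x + t *s g x) ` X)) < dim (span (V \<union> f ` X))}"
    (is "finite ?Bad")
proof -
  interpret f: module_hom scale scale f by fact
  interpret g: module_hom scale scale g by fact
  define h where "h t x = f x + t *s g x" for t x
  have h: "module_hom scale scale (h t)" for t
    unfolding h_def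
    by (intro module_hom_iff[THEN iffD2] conjI allI module_axioms)
       (simp_all add: f.add g.add f.scale g.scale algebra_simps scale_right_distrib mult.commute)
  define K where "K = {x \<in> X. f x \<in> V}"
  have K: "subspace K" "K \<subseteq> X"
    unfolding K_def using V X by (auto simp: subspace_def f.add f.scale f.zero)
  obtain C where C: "C \<subseteq> X" "finite C" "independent C" "card C + dim K = dim X"
    "\<And>x. x \<in> span C \<Longrightarrow> x \<in> K \<Longrightarrow> x = 0" "X \<subseteq> span (K \<union> C)"
    using complement_exists[OF X K] by metis
  have spanC: "span C \<subseteq> X"
    using C(1) X(1) by (rule span_minimal)
  have finC: "finspan (span C)"
    using C(2) unfolding finspan_def by blast
  have CK: "x = 0" if "x \<in> span C" "f x \<in> V" for x
    using that spanC C(5) K_def by blast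
  have rank: "dim (span (V \<union> f ` X)) = dim V + card C"
    using dim_union_image[OF f V X] C(4) K_def by simp
  \<comment> \<open>On \<open>span C\<close> the map \<open>f\<close> already attains its full rank
    modulo \<open>V\<close>. If \<open>h t\<close> were injective modulo \<open>V\<close> there, its
    rank could not be smaller.\<close>
  have "\<exists>v. v \<in> span C \<and> v \<noteq> 0 \<and> h t v \<in> V" if t: "t \<in> ?Bad" for t
  proof (rule ccontr)
    assume "\<not> ?thesis"
    then have "{x \<in> span C. h t x \<in> V} \<subseteq> span {}"
      by auto
    then have "dim {x \<in> span C. h t x \<in> V} = 0"
      using dim_le_card[of _ "{}"] by auto
    then have "dim (span (V \<union> h t ` span C)) = dim V + card C"
      using dim_union_image[OF h V subspace_span finC, of t] C(3)
      by (simp add: dim_eq_card_independent)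
    moreover have "dim (span (V \<union> h t ` span C)) \<le> dim (span (V \<union> h t ` X))"
      using spanC by (intro finspan_dim_mono finspan_union_image h V X span_mono) auto
    ultimately show False
      using t rank by (simp add: h_def)
  qed
  then have "\<forall>t\<in>?Bad. \<exists>v. v \<in> span C \<and> v \<noteq> 0 \<and> h t v \<in> V"
    by blast
  then have "\<exists>v. \<forall>t\<in>?Bad. v t \<in> span C \<and> v t \<noteq> 0 \<and> h t (v t) \<in> V"
    by (rule bchoice)
  then obtain v where v: "v t \<in> span C" "v t \<noteq> 0" "h t (v t) \<in> V" if "t \<in> ?Bad" for t
    by blast
  \<comment> \<open>\<open>h 0\<close> is \<open>f\<close>, which kills no nonzero vector of
    \<open>span C\<close> modulo \<open>V\<close>; this permits division by \<open>t\<close>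
    below.\<close>
  have nz: "t \<noteq> 0" if "t \<in> ?Bad" for t
    using v[OF that] CK[of "v t"] by (auto simp: h_def)
  have indep: "\<forall>t\<in>F. a t = 0" if "finite F" "F \<subseteq> ?Bad" "(\<Sum>t\<in>F. a t *s v t) = 0" for F a
    using that
  proof (induction F arbitrary: a)
    case (insert s F)
    let ?F = "insert s F"
    \<comment> \<open>The weight vanishes at \<open>t = s\<close>, which removes one vector. Since
      \<open>f (v t)\<close> is \<open>- t *s g (v t)\<close> modulo \<open>V\<close>, the given
      relation puts \<open>f w\<close> into \<open>V\<close>, and injectivity on
      \<open>span C\<close> yields \<open>w = 0\<close>.\<close>
    define w where "w = (\<Sum>t\<in>?F. (a t * (1 - s / t)) *s v t)"
    have w_F: "w = (\<Sum>t\<in>F. (a t * (1 - s / t)) *s v t)"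
      using insert.hyps nz[of s] insert.prems(1) by (simp add: w_def)
    have "f w = (\<Sum>t\<in>?F. a t *s f (v t)) - s *s (\<Sum>t\<in>?F. (a t / t) *s f (v t))"
      unfolding w_def f.sum f.scale scale_sum_right sum_subtractf[symmetric]
      by (intro sum.cong refl) (simp add: algebra_simps scale_left_diff_distrib)
    also have "(\<Sum>t\<in>?F. a t *s f (v t)) = f (\<Sum>t\<in>?F. a t *s v t)"
      unfolding f.sum f.scale ..
    also have "\<dots> = 0"
      unfolding insert.prems(2) by (rule f.zero)
    also have "(\<Sum>t\<in>?F. (a t / t) *s f (v t))
        = (\<Sum>t\<in>?F. (a t / t) *s h t (v t)) - (\<Sum>t\<in>?F. a t *s g (v t))"
      unfolding sum_subtractf[symmetric]
    proof (rule sum.cong)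
      fix t assume "t \<in> ?F"
      then have "t \<noteq> 0"
        using nz insert.prems(1) by blast
      then show "(a t / t) *s f (v t) = (a t / t) *s h t (v t) - a t *s g (v t)"
        by (simp add: h_def scale_right_distrib)
    qed simp
    also have "(\<Sum>t\<in>?F. a t *s g (v t)) = g (\<Sum>t\<in>?F. a t *s v t)"
      unfolding g.sum g.scale ..
    also have "\<dots> = 0"
      unfolding insert.prems(2) by (rule g.zero)
    finally have "f w = - (s *s (\<Sum>t\<in>?F. (a t / t) *s h t (v t)))"
      by simp
    moreover have "(\<Sum>t\<in>?F. (a t / t) *s h t (v t)) \<in> V"
      using V(1) v(3) insert.prems(1) by (intro subspace_sum subspace_scale) auto
    ultimately have "f w \<in> V"
      using V(1) by (simp add: subspace_neg subspace_scale)
    moreover have "w \<in> span C"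
      unfolding w_def using v(1) insert.prems(1) by (intro span_sum span_scale) auto
    ultimately have "w = 0"
      by (intro CK)
    then have "\<forall>t\<in>F. a t * (1 - s / t) = 0"
      using insert.IH[of "\<lambda>t. a t * (1 - s / t)"] insert.prems(1) w_F by simp
    moreover have "1 - s / t \<noteq> 0" if "t \<in> F" for t
      using that insert.hyps(2) nz[of t] insert.prems(1) by auto
    ultimately have F: "\<forall>t\<in>F. a t = 0"
      by (metis mult_eq_0_iff)
    then have "a s *s v s = 0"
      using insert.prems(2) insert.hyps by simp
    then have "a s = 0"
      using v(2)[of s] insert.prems(1) by simp
    with F show ?case
      by simp
  qed simp
  have "card F \<le> card C" if F: "finite F" "F \<subseteq> ?Bad" for F
  proof -
    have inj: "inj_on v F"
    proof (rule inj_onI, rule ccontr)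
      fix s t assume st: "s \<in> F" "t \<in> F" "v s = v t" "s \<noteq> t"
      then have "\<forall>u\<in>{s, t}. (if u = s then 1 else - 1 :: 'a) = 0"
        using F by (intro indep) auto
      then show False
        by simp
    qed
    have "independent (v ` F)"
    proof (rule independent_if_scalars_zero)
      fix b x assume "(\<Sum>x\<in>v ` F. b x *s x) = 0" "x \<in> v ` F"
      then show "b x = 0"
        using indep[OF F, of "\<lambda>t. b (v t)"] inj by (auto simp: sum.reindex)
    qed (use F in simp)
    moreover have "v ` F \<subseteq> span C"
      using v(1) F by blast
    ultimately have "card (v ` F) \<le> card C"
      using independent_span_bound[OF C(2)] by blast
    then show ?thesis
      using inj by (simp add: card_image)
  qed
  then show "finite ?Bad"
    using infinite_arbitrarily_large[of ?Bad "Suc (card C)"] by fastforce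
qed

end

section \<open>Spaces of forms\<close>

lemma smult_mult_left: "smult c (p * q) = smult c p * (q :: 'a::comm_ring_1 mpoly)"
  by (simp add: smult_def mult.assoc)

lemma smult_mult_right: "smult c (p * q) = p * smult c (q :: 'a::comm_ring_1 mpoly)"
  by (simp add: smult_def mult_ac)

interpretation mpoly: vector_space "smult :: 'a::field \<Rightarrow> 'a mpoly \<Rightarrow> 'a mpoly"
proof
  show "smult a (smult b p) = smult (a * b) p" for a b :: 'a and p
    by (simp add: smult_def mult_single flip: mult.assoc)
qed (simp_all add: smult_def distrib_left distrib_right single_add)

abbreviation forms :: "nat \<Rightarrow> nat \<Rightarrow> 'a::zero mpoly set" where
  "forms r d \<equiv> graded_part r UNIV d"

definition monoms :: "nat \<Rightarrow> nat \<Rightarrow> (nat \<Rightarrow>\<^sub>0 nat) set" where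
  "monoms r d = {m. Poly_Mapping.keys m \<subseteq> {..<r} \<and> mdeg m = d}"

lemma forms_iff: "p \<in> forms r d \<longleftrightarrow> Poly_Mapping.keys p \<subseteq> monoms r d"
  by (auto simp: graded_part_def polys_def homog_def monoms_def)

lemma lookup_smult: "Poly_Mapping.lookup (smult c p) m = c * Poly_Mapping.lookup p m"
  by (simp add: smult_def mult_map_scale_conv_mult[symmetric] map.rep_eq when_def)

lemma subspace_forms: "mpoly.subspace (forms r d :: 'a::field mpoly set)"
proof (unfold mpoly.subspace_def, intro conjI ballI allI)
  fix p q :: "'a mpoly" and c :: 'a
  assume p: "p \<in> forms r d"
  then show "smult c p \<in> forms r d"
    by (auto simp: forms_iff in_keys_iff lookup_smult)
  assume "q \<in> forms r d"
  with p show "p + q \<in> forms r d"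
    using Poly_Mapping.keys_add[of p q] by (auto simp: forms_iff)
qed (simp add: forms_iff)

lemma mdeg_superset:
  assumes "finite S" "Poly_Mapping.keys m \<subseteq> S"
  shows "mdeg m = (\<Sum>j\<in>S. Poly_Mapping.lookup m j)"
  unfolding mdeg_def using assms by (intro sum.mono_neutral_left) (auto simp: in_keys_iff)

lemma mdeg_add: "mdeg (m + n) = mdeg m + mdeg n"
proof -
  have "Poly_Mapping.keys (m + n) \<subseteq> Poly_Mapping.keys m \<union> Poly_Mapping.keys n"
    by (rule Poly_Mapping.keys_add)
  then show ?thesis
    by (simp add: mdeg_superset[of "Poly_Mapping.keys m \<union> Poly_Mapping.keys n"] lookup_add sum.distrib)
qed

lemma mdeg_single: "mdeg (Poly_Mapping.single j n) = n"
  by (simp add: mdeg_superset[of "{j}"])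

lemma monoms_add: "m \<in> monoms r a \<Longrightarrow> n \<in> monoms r b \<Longrightarrow> m + n \<in> monoms r (a + b)"
  using Poly_Mapping.keys_add[of m n] by (auto simp: monoms_def mdeg_add)

lemma forms_mult: "p \<in> forms r a \<Longrightarrow> q \<in> forms r b \<Longrightarrow> p * q \<in> forms r (a + b)"
  using keys_mult[of p q] monoms_add unfolding forms_iff by blast

lemma finite_monoms: "finite (monoms r d)"
proof (rule finite_imageD)
  have "Poly_Mapping.lookup m j \<le> mdeg m" for m j
  proof (cases "j \<in> Poly_Mapping.keys m")
    case True
    then show ?thesis
      unfolding mdeg_def by (intro member_le_sum) auto
  qed (simp add: in_keys_iff)
  then have "Poly_Mapping.lookup ` monoms r d \<subseteq>
      {f. \<forall>j. (j \<in> {..<r} \<longrightarrow> f j \<in> {..d}) \<and> (j \<notin> {..<r} \<longrightarrow> f j = 0)}"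
    by (force simp: monoms_def in_keys_iff)
  moreover have "finite \<dots>"
    by (rule finite_set_of_finite_funs) auto
  ultimately show "finite (Poly_Mapping.lookup ` monoms r d)"
    by (rule finite_subset)
qed (auto intro!: inj_onI poly_mapping_eqI)

lemma mpoly_monom_sum:
  "(p :: 'a::field mpoly) = (\<Sum>m\<in>Poly_Mapping.keys p. smult (Poly_Mapping.lookup p m) (Poly_Mapping.single m 1))"
proof (rule poly_mapping_eqI)
  fix k
  have "Poly_Mapping.lookup p m * Poly_Mapping.lookup (Poly_Mapping.single m 1) k
      = (if m = k then Poly_Mapping.lookup p m else 0)" for m
    by (simp add: lookup_single when_def)
  then show "Poly_Mapping.lookup p k = Poly_Mapping.lookup
      (\<Sum>m\<in>Poly_Mapping.keys p. smult (Poly_Mapping.lookup p m) (Poly_Mapping.single m 1)) k"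
    by (simp add: lookup_sum lookup_smult sum.delta in_keys_iff)
qed

lemma mpoly_in_span_monoms:
  assumes "\<And>m. m \<in> Poly_Mapping.keys p \<Longrightarrow> Poly_Mapping.single m 1 \<in> mpoly.span S"
  shows "(p :: 'a::field mpoly) \<in> mpoly.span S"
  by (subst mpoly_monom_sum) (intro mpoly.span_sum mpoly.span_scale assms)

lemma finspan_forms: "mpoly.finspan (forms r d :: 'a::field mpoly set)"
  unfolding mpoly.finspan_def
proof (intro exI conjI subsetI)
  show "finite ((\<lambda>m. Poly_Mapping.single m (1::'a)) ` monoms r d)"
    using finite_monoms by blast
  fix p :: "'a mpoly" assume "p \<in> forms r d"
  then show "p \<in> mpoly.span ((\<lambda>m. Poly_Mapping.single m 1) ` monoms r d)"
    by (rule_tac mpoly_in_span_monoms, intro mpoly.span_base) (auto simp: forms_iff)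
qed

lemma var_in_forms: "j < r \<Longrightarrow> (var j :: 'a::field mpoly) \<in> forms r 1"
  by (auto simp: forms_iff var_def monoms_def mdeg_single)

text \<open>Every monomial of positive degree is divisible by a variable.\<close>

lemma forms_Suc_subset_span:
  "(forms r (Suc d) :: 'a::field mpoly set) \<subseteq> mpoly.span {var j * x |j x. j < r \<and> x \<in> forms r d}"
proof
  fix p :: "'a mpoly" assume p: "p \<in> forms r (Suc d)"
  show "p \<in> mpoly.span {var j * x |j x. j < r \<and> x \<in> forms r d}"
  proof (rule mpoly_in_span_monoms, rule mpoly.span_base)
    fix m assume "m \<in> Poly_Mapping.keys p"
    then have m: "Poly_Mapping.keys m \<subseteq> {..<r}" "mdeg m = Suc d"
      using p by (auto simp: forms_iff monoms_def)
    then obtain j where j: "j \<in> Poly_Mapping.keys m"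
      unfolding mdeg_def by fastforce
    define n where "n = m - Poly_Mapping.single j 1"
    have mn: "m = Poly_Mapping.single j 1 + n"
      using j by (auto simp: n_def lookup_add lookup_minus lookup_single when_def in_keys_iff intro!: poly_mapping_eqI)
    have "mdeg n = d"
      using m(2) by (subst (asm) mn) (simp add: mdeg_add mdeg_single)
    moreover have "Poly_Mapping.keys n \<subseteq> Poly_Mapping.keys m"
      by (auto simp: n_def in_keys_iff lookup_minus)
    ultimately have "Poly_Mapping.single n (1::'a) \<in> forms r d"
      using m(1) by (auto simp: forms_iff monoms_def)
    moreover have "Poly_Mapping.single m (1::'a) = var j * Poly_Mapping.single n 1"
      by (subst mn) (simp add: var_def mult_single)
    ultimately show "Poly_Mapping.single m (1::'a) \<in> {var j * x |j x. j < r \<and> x \<in> forms r d}"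
      using j m(1) by blast
  qed
qed

lemma mult_hom: "module_hom smult smult ((*) (p :: 'a::field mpoly))"
  by (intro module_hom_iff[THEN iffD2] conjI allI mpoly.module_axioms)
     (simp_all add: distrib_left smult_mult_right)

section \<open>Hyperplane restriction\<close>

text \<open>\<open>V\<close> is meant to lie in degree \<open>d + 1\<close>; \<open>d\<close> is the
  degree that \<open>L\<close> multiplies. For \<open>V\<close> the degree \<open>d + 1\<close> part
  of \<open>I\<close>, the codimension here is the dimension of \<open>A/LA\<close> in degree
  \<open>d + 1\<close>, and that of \<open>colon_space\<close> is the rank of \<open>L\<close> from
  degree \<open>d\<close> to \<open>d + 1\<close>.\<close>

definition cut_space :: "nat \<Rightarrow> nat \<Rightarrow> 'a::field mpoly set \<Rightarrow> 'a mpoly \<Rightarrow> 'a mpoly set" where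
  "cut_space r d V L = mpoly.span (V \<union> (*) L ` forms r d)"

definition colon_space :: "nat \<Rightarrow> nat \<Rightarrow> 'a::field mpoly set \<Rightarrow> 'a mpoly \<Rightarrow> 'a mpoly set" where
  "colon_space r d V L = {x \<in> forms r d. L * x \<in> V}"

definition codim :: "nat \<Rightarrow> nat \<Rightarrow> 'a::field mpoly set \<Rightarrow> nat" where
  "codim r d V = mpoly.dim (forms r d :: 'a mpoly set) - mpoly.dim V"

definition form_space :: "nat \<Rightarrow> nat \<Rightarrow> 'a::field mpoly set \<Rightarrow> bool" where
  "form_space r d V \<longleftrightarrow> mpoly.subspace V \<and> V \<subseteq> forms r d"

lemma form_space_finspan: "form_space r d V \<Longrightarrow> mpoly.finspan V"
  unfolding form_space_def using mpoly.finspan_subset[OF finspan_forms] by blast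

lemma dim_add_codim:
  "form_space r d (V :: 'a::field mpoly set) \<Longrightarrow> mpoly.dim V + codim r d V = mpoly.dim (forms r d :: 'a mpoly set)"
  using mpoly.finspan_dim_mono[OF finspan_forms, of V] by (auto simp: form_space_def codim_def)

lemma codim_antimono:
  assumes "form_space r d W" "V \<subseteq> W"
  shows "codim r d W \<le> codim r d V"
  unfolding codim_def
  using mpoly.finspan_dim_mono[OF form_space_finspan[OF assms(1)] assms(2)] by simp

lemma subset_cut: "V \<subseteq> cut_space r d V L"
  unfolding cut_space_def using mpoly.span_superset by blast

lemma mult_in_cut: "x \<in> forms r d \<Longrightarrow> L * x \<in> cut_space r d V L"
  unfolding cut_space_def by (intro mpoly.span_base) blast

lemma form_space_cut:
  assumes "form_space r (Suc d) V" "L \<in> forms r 1"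
  shows "form_space r (Suc d) (cut_space r d V L)"
  unfolding form_space_def cut_space_def
proof
  have "L * x \<in> forms r (Suc d)" if "x \<in> forms r d" for x
    using forms_mult[OF assms(2) that] by simp
  then show "mpoly.span (V \<union> (*) L ` forms r d) \<subseteq> forms r (Suc d)"
    using assms(1) by (intro mpoly.span_minimal subspace_forms) (auto simp: form_space_def)
qed (rule mpoly.subspace_span)

lemma form_space_colon:
  assumes "form_space r (Suc d) V"
  shows "form_space r d (colon_space r d V L)"
proof -
  have V: "mpoly.subspace V"
    using assms by (simp add: form_space_def)
  have "mpoly.subspace (colon_space r d V L)"
    unfolding colon_space_def
  proof (rule mpoly.subspaceI)
    show "0 \<in> {x \<in> forms r d. L * x \<in> V}"
      using mpoly.subspace_0[OF V] mpoly.subspace_0[OF subspace_forms] by simp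
    fix x assume x: "x \<in> {x \<in> forms r d. L * x \<in> V}"
    show "smult c x \<in> {x \<in> forms r d. L * x \<in> V}" for c
      using x mpoly.subspace_scale[OF V, of "L * x" c] mpoly.subspace_scale[OF subspace_forms, of x r d c]
      by (simp add: smult_mult_right)
    show "x + y \<in> {x \<in> forms r d. L * x \<in> V}" if "y \<in> {x \<in> forms r d. L * x \<in> V}" for y
      using x that mpoly.subspace_add[OF V] mpoly.subspace_add[OF subspace_forms, of x r d y]
      by (simp add: distrib_left)
  qed
  then show ?thesis
    by (auto simp: form_space_def colon_space_def)
qed

text \<open>Rank-nullity for multiplication by \<open>L\<close> from degree \<open>d\<close> into
  degree \<open>d + 1\<close> modulo \<open>V\<close>.\<close>

lemma codim_cut_colon:
  assumes "form_space r (Suc d) V" "L \<in> forms r 1"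
  shows "codim r (Suc d) V = codim r (Suc d) (cut_space r d V L) + codim r d (colon_space r d V L)"
proof -
  have "mpoly.dim (cut_space r d V L) + mpoly.dim (colon_space r d V L) = mpoly.dim V + mpoly.dim (forms r d :: 'a mpoly set)"
    unfolding cut_space_def colon_space_def using assms(1) form_space_finspan[OF assms(1)]
    by (intro mpoly.dim_union_image mult_hom subspace_forms finspan_forms) (auto simp: form_space_def)
  then show ?thesis
    using dim_add_codim[OF assms(1)] dim_add_codim[OF form_space_cut[OF assms]]
      dim_add_codim[OF form_space_colon[OF assms(1)], of L] by linarith
qed

section \<open>Generic linear forms\<close>

lemma pencil_in_forms:
  fixes L M :: "'a::field mpoly"
  assumes "L \<in> forms r 1" "M \<in> forms r 1"
  shows "L + smult t M \<in> forms r 1"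
  using assms by (intro mpoly.subspace_add[OF subspace_forms] mpoly.subspace_scale[OF subspace_forms])

text \<open>A substitute for nonempty Zariski-open sets of linear forms: openness is only
  required along lines.\<close>
definition generic :: "nat \<Rightarrow> ('a::field mpoly \<Rightarrow> bool) \<Rightarrow> bool" where
  "generic r P \<longleftrightarrow> (\<exists>L\<in>forms r 1. P L) \<and>
     (\<forall>L\<in>forms r 1. \<forall>M\<in>forms r 1. P L \<longrightarrow> finite {t. \<not> P (L + smult t M)})"

text \<open>On the line joining a form with \<open>P\<close> to one with \<open>Q\<close>, each
  property fails for finitely many parameters only; an infinite field leaves a common good
  one.\<close>

lemma generic_conj:
  fixes P Q :: "'a::field mpoly \<Rightarrow> bool"
  assumes "infinite (UNIV :: 'a set)" "generic r P" "generic r Q"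
  shows "generic r (\<lambda>L. P L \<and> Q L)"
proof -
  obtain L M where L: "L \<in> forms r 1" "P L" and M: "M \<in> forms r 1" "Q M"
    using assms(2,3) unfolding generic_def by blast
  have diff: "M - L \<in> forms r 1" "L - M \<in> forms r 1"
    using L(1) M(1) subspace_forms by (auto intro: mpoly.subspace_diff)
  have "finite {t. \<not> P (L + smult t (M - L))}"
    using assms(2) L diff unfolding generic_def by blast
  \<comment> \<open>Seen from \<open>M\<close>, the same line has parameter
    \<open>1 - t\<close>.\<close>
  moreover have "finite ((\<lambda>t. 1 - t) ` {t. \<not> Q (M + smult t (L - M))})"
    using assms(3) M diff unfolding generic_def by blast
  ultimately obtain t where t: "t \<notin> {t. \<not> P (L + smult t (M - L))}"
      "t \<notin> (\<lambda>t. 1 - t) ` {t. \<not> Q (M + smult t (L - M))}"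
    using ex_new_if_finite[OF assms(1), of "{t. \<not> P (L + smult t (M - L))}
      \<union> (\<lambda>t. 1 - t) ` {t. \<not> Q (M + smult t (L - M))}"] by auto
  have "L + smult t (M - L) = M + smult (1 - t) (L - M)"
    by (simp add: mpoly.scale_right_diff_distrib mpoly.scale_left_diff_distrib)
  moreover have "Q (M + smult (1 - t) (L - M))"
    using t(2) by (metis (mono_tags, lifting) diff_diff_eq2 add_diff_cancel_left' imageI mem_Collect_eq)
  ultimately have "P (L + smult t (M - L))" "Q (L + smult t (M - L))"
    using t(1) by auto
  then have "\<exists>L\<in>forms r 1. P L \<and> Q L"
    using pencil_in_forms[OF L(1) diff(1)] by blast
  moreover have "finite {t. \<not> (P (L + smult t M) \<and> Q (L + smult t M))}"
    if "L \<in> forms r 1" "M \<in> forms r 1" "P L" "Q L" for L M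
  proof -
    have "finite ({t. \<not> P (L + smult t M)} \<union> {t. \<not> Q (L + smult t M)})"
      using assms(2,3) that unfolding generic_def by blast
    then show ?thesis
      by (rule rev_finite_subset) auto
  qed
  ultimately show ?thesis
    unfolding generic_def by blast
qed

text \<open>Along a line the multiplication maps form a pencil, and the codimension of the cut
  exceeds its value at \<open>L\<close> only where the rank drops.\<close>

lemma generic_codim_cut:
  assumes V: "form_space r (Suc d) V" and L0: "L0 \<in> forms r 1" "codim r (Suc d) (cut_space r d V L0) \<le> n"
  shows "generic r (\<lambda>L. codim r (Suc d) (cut_space r d V L) \<le> n)"
  unfolding generic_def
proof (intro conjI ballI impI)
  show "\<exists>L\<in>forms r 1. codim r (Suc d) (cut_space r d V L) \<le> n"
    using L0 by blast
  fix L M :: "'a mpoly" assume L: "L \<in> forms r 1" "codim r (Suc d) (cut_space r d V L) \<le> n" and M: "M \<in> forms r 1"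
  have "finite {t. mpoly.dim (mpoly.span (V \<union> (\<lambda>x. L * x + smult t (M * x)) ` forms r d))
      < mpoly.dim (mpoly.span (V \<union> (*) L ` forms r d))}"
    using V form_space_finspan[OF V]
    by (intro mpoly.finite_rank_drop mult_hom subspace_forms finspan_forms) (auto simp: form_space_def)
  moreover have "(\<lambda>x. L * x + smult t (M * x)) ` X = (*) (L + smult t M) ` X" for t X
    by (rule image_cong) (simp_all only: distrib_right smult_mult_left)
  ultimately have "finite {t. mpoly.dim (cut_space r d V (L + smult t M)) < mpoly.dim (cut_space r d V L)}"
    unfolding cut_space_def by (simp only:)
  then show "finite {t. \<not> codim r (Suc d) (cut_space r d V (L + smult t M)) \<le> n}"
    by (rule rev_finite_subset) (use L(2) in \<open>auto simp: codim_def\<close>)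
qed

text \<open>If no linear form enlarges \<open>V\<close>, then \<open>V\<close> contains all products
  of a variable with a form of degree \<open>d\<close>, and these span degree
  \<open>d + 1\<close>.\<close>

lemma exists_proper_cut:
  fixes V :: "'a::field mpoly set"
  assumes V: "form_space r (Suc d) V" and "0 < codim r (Suc d) V"
  shows "\<exists>L\<in>forms r 1. codim r (Suc d) (cut_space r d V L) < codim r (Suc d) V"
proof (rule ccontr)
  assume *: "\<not> ?thesis"
  have "cut_space r d V L = V" if L: "L \<in> forms r 1" for L
  proof -
    have "codim r (Suc d) V \<le> codim r (Suc d) (cut_space r d V L)"
      using * L by (simp add: not_less)
    then have "mpoly.dim (cut_space r d V L) \<le> mpoly.dim V"
      using dim_add_codim[OF V] dim_add_codim[OF form_space_cut[OF V L]] by linarith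
    then show ?thesis
      using mpoly.finspan_subspace_eq[OF form_space_finspan[OF form_space_cut[OF V L]], of V]
        V subset_cut by (metis form_space_def)
  qed
  then have "var j * x \<in> V" if "j < r" "x \<in> forms r d" for j x
    using mult_in_cut[of x r d "var j" V] var_in_forms[OF that(1), where 'a = 'a] that(2) by metis
  then have "mpoly.span {var j * x |j x. j < r \<and> x \<in> forms r d} \<subseteq> V"
    using V by (intro mpoly.span_minimal) (auto simp: form_space_def)
  then have "forms r (Suc d) \<subseteq> V"
    using forms_Suc_subset_span by blast
  then have "codim r (Suc d) V = 0"
    using V by (simp add: codim_def form_space_def subset_antisym)
  then show False
    using assms(2) by simp
qed

text \<open>In the main case \<open>L1\<close> minimises the codimension \<open>c\<close> of the
  cut. Cutting first by a generic \<open>M\<close> and then by \<open>L1\<close> bounds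
  \<open>c\<close> by the Green numbers of \<open>c\<close> and of the colon codimension
  \<open>b\<close>, which is the hypothesis of \<open>green_superadditive\<close>.\<close>

theorem green_hyperplane_restriction:
  fixes V :: "'a::field mpoly set"
  assumes inf: "infinite (UNIV :: 'a set)" and "form_space r (Suc d) V"
  shows "\<exists>L\<in>forms r 1. codim r (Suc d) (cut_space r d V L) \<le> green (Suc d) (codim r (Suc d) V)"
  using assms(2)
proof (induction d arbitrary: V)
  case (0 V)
  show ?case
  proof (cases "codim r (Suc 0) V = 0")
    case True
    have zero: "(0 :: 'a mpoly) \<in> forms r 1"
      using subspace_forms by (rule mpoly.subspace_0)
    show ?thesis
      using codim_antimono[OF form_space_cut[OF 0 zero] subset_cut] True zero by (metis le_zero_eq zero_le)
  next
    case False
    then obtain L where "L \<in> forms r 1" "codim r (Suc 0) (cut_space r 0 V L) < codim r (Suc 0) V"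
      using exists_proper_cut[OF 0] by auto
    \<comment> \<open>In degree 1 Green's bound is the codimension minus one, so any strict decrease
      suffices.\<close>
    moreover have "green (Suc 0) (codim r (Suc 0) V) = codim r (Suc 0) V - 1"
      using green_cascade[of 0 "codim r (Suc 0) V" 0] False by simp
    ultimately show ?thesis
      by (intro bexI[of _ L]) auto
  qed
next
  case (Suc d V)
  note outer = Suc.IH
  from Suc.prems show ?case
  proof (induction "codim r (Suc (Suc d)) V" arbitrary: V rule: less_induct)
    case (less V)
    let ?c = "\<lambda>V. codim r (Suc (Suc d)) V" and ?cut = "cut_space r (Suc d)"
    show ?case
    proof (cases "?c V = 0")
      case True
      have zero: "(0 :: 'a mpoly) \<in> forms r 1"
        using subspace_forms by (rule mpoly.subspace_0)
      show ?thesis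
        using codim_antimono[OF form_space_cut[OF less.prems zero] subset_cut] True zero
        by (metis le_zero_eq zero_le)
    next
      case False
      then obtain L0 where L0: "L0 \<in> forms r 1" "?c (?cut V L0) < ?c V"
        using exists_proper_cut[OF less.prems] by auto
      obtain L1 where L1: "L1 \<in> forms r 1"
        and min: "\<And>L. L \<in> forms r 1 \<Longrightarrow> ?c (?cut V L1) \<le> ?c (?cut V L)"
        using L0(1) ex_has_least_nat[of "\<lambda>L. L \<in> forms r 1" L0 "\<lambda>L. ?c (?cut V L)"] by blast
      define c where "c = ?c (?cut V L1)"
      define b where "b = codim r (Suc d) (colon_space r (Suc d) V L1)"
      have c_less: "c < ?c V"
        using min[OF L0(1)] L0(2) by (simp add: c_def)
      have sum: "?c V = c + b"
        unfolding c_def b_def by (rule codim_cut_colon[OF less.prems L1])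
      note W = form_space_cut[OF less.prems L1]
      note K = form_space_colon[OF less.prems, of L1]
      \<comment> \<open>The cut by \<open>L1\<close> has smaller codimension, so the inner induction
        applies to it; the colon space lies one degree lower and falls under the outer one.\<close>
      have "\<exists>L\<in>forms r 1. ?c (?cut (?cut V L1) L) \<le> green (Suc (Suc d)) c"
        using less.hyps[OF _ W] c_less unfolding c_def by blast
      then have g1: "generic r (\<lambda>L. ?c (?cut (?cut V L1) L) \<le> green (Suc (Suc d)) c)"
        using generic_codim_cut[OF W] by blast
      have "\<exists>L\<in>forms r 1. codim r (Suc d) (cut_space r d (colon_space r (Suc d) V L1) L) \<le> green (Suc d) b"
        using outer[OF K] unfolding b_def by blast
      then have g2: "generic r (\<lambda>L. codim r (Suc d) (cut_space r d (colon_space r (Suc d) V L1) L) \<le> green (Suc d) b)"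
        using generic_codim_cut[OF K] by blast
      have g3: "generic r (\<lambda>L. ?c (?cut V L) \<le> c)"
        using generic_codim_cut[OF less.prems L1] by (simp add: c_def)
      \<comment> \<open>The third condition, with the minimality of \<open>c\<close>, makes
        \<open>M\<close> a minimiser as well.\<close>
      obtain M where M: "M \<in> forms r 1" "?c (?cut (?cut V L1) M) \<le> green (Suc (Suc d)) c"
          "codim r (Suc d) (cut_space r d (colon_space r (Suc d) V L1) M) \<le> green (Suc d) b" "?c (?cut V M) \<le> c"
        using generic_conj[OF inf g1 generic_conj[OF inf g2 g3]] unfolding generic_def by blast
      note W' = form_space_cut[OF less.prems M(1)]
      have "c = ?c (?cut V M)"
        using M(4) min[OF M(1)] by (simp add: c_def)
      also have "\<dots> = ?c (?cut (?cut V M) L1) + codim r (Suc d) (colon_space r (Suc d) (?cut V M) L1)"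
        by (rule codim_cut_colon[OF W' L1])
      also have "?cut (?cut V M) L1 = ?cut (?cut V L1) M"
      proof -
        have "?cut (?cut V A) B = mpoly.span (V \<union> (*) A ` forms r (Suc d) \<union> (*) B ` forms r (Suc d))" for A B
          unfolding cut_space_def by (simp only: mpoly.span_Un[of "mpoly.span _"] mpoly.span_Un[of "_ \<union> _"] mpoly.span_span)
        then show ?thesis
          by (simp only: Un_ac)
      qed
      \<comment> \<open>Since \<open>L1 * (M * y) = M * (L1 * y)\<close>, the colon space of the cut
        by \<open>M\<close> contains both \<open>V : L1\<close> and the multiples of
        \<open>M\<close>.\<close>
      also have "codim r (Suc d) (colon_space r (Suc d) (?cut V M) L1)
          \<le> codim r (Suc d) (cut_space r d (colon_space r (Suc d) V L1) M)"
      proof (rule codim_antimono)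
        note fs = form_space_colon[OF W', of L1]
        show "form_space r (Suc d) (colon_space r (Suc d) (?cut V M) L1)"
          by (rule fs)
        have "M * y \<in> colon_space r (Suc d) (?cut V M) L1" if y: "y \<in> forms r d" for y
        proof -
          have "M * y \<in> forms r (Suc d)" "L1 * y \<in> forms r (Suc d)"
            using forms_mult[OF M(1) y] forms_mult[OF L1 y] by simp_all
          then show ?thesis
            using mult_in_cut[of "L1 * y" r "Suc d" M V] by (simp add: colon_space_def mult.left_commute)
        qed
        moreover have "colon_space r (Suc d) V L1 \<subseteq> colon_space r (Suc d) (?cut V M) L1"
          using subset_cut[of V r "Suc d" M] unfolding colon_space_def by blast
        ultimately show "cut_space r d (colon_space r (Suc d) V L1) M \<subseteq> colon_space r (Suc d) (?cut V M) L1"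
          using fs unfolding cut_space_def by (intro mpoly.span_minimal) (auto simp: form_space_def cut_space_def)
      qed
      finally have "c \<le> green (Suc (Suc d)) c + green (Suc d) b"
        using M(2,3) by linarith
      then have "c \<le> green (Suc (Suc d)) (?c V)"
        unfolding sum by (rule green_superadditive)
      then show ?thesis
        using L1 unfolding c_def by blast
    qed
  qed
qed

text \<open>Macaulay's growth bound, turned from an upper bound in degree \<open>d + 1\<close> into a lower bound in
  degree \<open>d\<close>.\<close>
lemma macaulay_down_codim:
  fixes V :: "'a::field mpoly set"
  assumes inf: "infinite (UNIV :: 'a set)" and V: "form_space r (Suc d) V" and U: "form_space r d U"
    and mult: "\<And>L x. L \<in> forms r 1 \<Longrightarrow> x \<in> U \<Longrightarrow> L * x \<in> V"
  shows "macaulay_down (Suc d) (codim r (Suc d) V) \<le> codim r d U"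
proof -
  obtain L where L: "L \<in> forms r 1" "codim r (Suc d) (cut_space r d V L) \<le> green (Suc d) (codim r (Suc d) V)"
    using green_hyperplane_restriction[OF inf V] by blast
  have "codim r d (colon_space r d V L) \<le> codim r d U"
    using mult[OF L(1)] U by (intro codim_antimono form_space_colon[OF V]) (auto simp: colon_space_def form_space_def)
  then show ?thesis
    using codim_cut_colon[OF V L(1)] L(2) by (simp add: macaulay_down_def)
qed

lemma macaulay_iter_codim:
  fixes V :: "nat \<Rightarrow> 'a::field mpoly set"
  assumes inf: "infinite (UNIV :: 'a set)" and V: "\<And>j. d \<le> j \<Longrightarrow> form_space r j (V j)"
    and mult: "\<And>j L x. d \<le> j \<Longrightarrow> L \<in> forms r 1 \<Longrightarrow> x \<in> V j \<Longrightarrow> L * x \<in> V (Suc j)"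
  shows "macaulay_iter (d + s) s (codim r (d + s) (V (d + s))) \<le> codim r d (V d)"
proof (induction s)
  case (Suc s)
  have "macaulay_down (Suc (d + s)) (codim r (Suc (d + s)) (V (Suc (d + s)))) \<le> codim r (d + s) (V (d + s))"
    by (intro macaulay_down_codim inf V mult) auto
  then have "macaulay_iter (d + s) s (macaulay_down (Suc (d + s)) (codim r (Suc (d + s)) (V (Suc (d + s)))))
      \<le> macaulay_iter (d + s) s (codim r (d + s) (V (d + s)))"
    by (rule macaulay_iter_mono)
  with Suc.IH show ?case
    by simp
qed simp

section \<open>Duality in Gorenstein algebras\<close>

text \<open>One half of the equality of row and column rank, for the form sending \<open>x\<close>
  and \<open>y\<close> to \<open>z * (x * y)\<close> modulo \<open>W\<close>: each vector of a
  complement of the right radical imposes one linear condition on \<open>X\<close>.\<close>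

lemma pairing_codim_le:
  fixes X Y :: "'a::field mpoly set"
  assumes X: "mpoly.subspace X" "mpoly.finspan X" and Y: "mpoly.subspace Y" "mpoly.finspan Y"
    and W: "mpoly.subspace W" "W \<subseteq> U" and U: "mpoly.subspace U" "mpoly.finspan U"
    and dimU: "mpoly.dim U \<le> Suc (mpoly.dim W)"
    and prod: "\<And>x y. x \<in> X \<Longrightarrow> y \<in> Y \<Longrightarrow> z * (x * y) \<in> U"
  shows "mpoly.dim X + mpoly.dim {y \<in> Y. \<forall>x\<in>X. z * (x * y) \<in> W}
    \<le> mpoly.dim Y + mpoly.dim {x \<in> X. \<forall>y\<in>Y. z * (x * y) \<in> W}"
proof -
  have perp: "mpoly.subspace {y. z * (x * y) \<in> W}" for x
    using W(1) by (auto simp: mpoly.subspace_def distrib_left simp flip: smult_mult_right)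
  define K where "K = {y \<in> Y. \<forall>x\<in>X. z * (x * y) \<in> W}"
  have K: "mpoly.subspace K" "K \<subseteq> Y"
  proof -
    have "K = Y \<inter> (\<Inter>x\<in>X. {y. z * (x * y) \<in> W})"
      by (auto simp: K_def)
    then show "mpoly.subspace K"
      using Y(1) perp by (simp only:) (intro mpoly.subspace_inter mpoly.subspace_Inter, auto)
  qed (auto simp: K_def)
  obtain C where C: "C \<subseteq> Y" "finite C" "card C + mpoly.dim K = mpoly.dim Y"
      "Y \<subseteq> mpoly.span (K \<union> C)"
    using mpoly.complement_exists[OF Y K] by metis
  \<comment> \<open>A new \<open>y\<close> costs at most one dimension, because \<open>U\<close>
    exceeds \<open>W\<close> by at most one.\<close>
  have step: "mpoly.dim X \<le> mpoly.dim {x \<in> X. \<forall>y\<in>D. z * (x * y) \<in> W} + card D"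
    if "finite D" "D \<subseteq> Y" for D
    using that
  proof (induction D)
    case (insert y D)
    define X' where "X' = {x \<in> X. \<forall>y\<in>D. z * (x * y) \<in> W}"
    have X': "mpoly.subspace X'" "X' \<subseteq> X"
    proof -
      have "X' = X \<inter> (\<Inter>y\<in>D. {x. z * (y * x) \<in> W})"
        by (auto simp: X'_def mult.commute)
      then show "mpoly.subspace X'"
        using X(1) perp by (simp only:) (intro mpoly.subspace_inter mpoly.subspace_Inter, auto)
    qed (auto simp: X'_def)
    have "mpoly.dim (mpoly.span (W \<union> (*) (z * y) ` X')) + mpoly.dim {x \<in> X'. z * y * x \<in> W}
        = mpoly.dim W + mpoly.dim X'"
      using mpoly.finspan_subset[OF U(2) W(2)] mpoly.finspan_subset[OF X(2) X'(2)]
      by (intro mpoly.dim_union_image mult_hom W X')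
    moreover have "mpoly.dim (mpoly.span (W \<union> (*) (z * y) ` X')) \<le> mpoly.dim U"
    proof (intro mpoly.finspan_dim_mono U mpoly.span_minimal)
      show "W \<union> (*) (z * y) ` X' \<subseteq> U"
        using W(2) prod X'(2) insert.prems by (auto simp: mult.assoc mult.left_commute mult.commute)
    qed
    moreover have "{x \<in> X'. z * y * x \<in> W} = {x \<in> X. \<forall>y\<in>insert y D. z * (x * y) \<in> W}"
      by (auto simp: X'_def mult_ac)
    moreover have "mpoly.dim X \<le> mpoly.dim X' + card D"
      using insert unfolding X'_def by simp
    ultimately show ?case
      using dimU insert.hyps by simp
  qed simp
  \<comment> \<open>\<open>K\<close> is orthogonal to all of \<open>X\<close>, so testing against
    \<open>C\<close> is testing against \<open>Y\<close>.\<close>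
  have "{x \<in> X. \<forall>y\<in>C. z * (x * y) \<in> W} = {x \<in> X. \<forall>y\<in>Y. z * (x * y) \<in> W}"
  proof (intro Collect_cong conj_cong refl iffI ballI)
    fix x y assume x: "x \<in> X" "\<forall>y\<in>C. z * (x * y) \<in> W" and "y \<in> Y"
    have "mpoly.span (K \<union> C) \<subseteq> {y. z * (x * y) \<in> W}"
      using x by (intro mpoly.span_minimal perp) (auto simp: K_def)
    then show "z * (x * y) \<in> W"
      using C(4) \<open>y \<in> Y\<close> by blast
  qed (use C(1) in blast)
  then show ?thesis
    using step[OF C(2,1)] C(3) unfolding K_def by simp
qed

text \<open>The two Hilbert function values locate the socle: \<open>e\<close> is the top nonzero
  degree, of dimension 1.\<close>

locale gorenstein_ideal =
  fixes r e :: nat and I :: "'a::field mpoly set"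
  assumes ideal: "ideal_in r I"
    and gorenstein: "artinian_gorenstein r I"
    and hilb_e: "hilb r I e = 1" and hilb_Suc_e: "hilb r I (Suc e) = 0"
begin

lemma mult_in_ideal: "p \<in> forms r a \<Longrightarrow> x \<in> I \<Longrightarrow> p * x \<in> I"
  using ideal by (auto simp: ideal_in_def graded_part_def)

lemma one_in_forms: "1 \<in> forms r 0"
  by (auto simp: forms_iff monoms_def mdeg_def)

lemma in_graded_part: "x \<in> graded_part r I d \<longleftrightarrow> x \<in> forms r d \<and> x \<in> I"
  by (auto simp: graded_part_def)

lemma form_space_graded_part: "form_space r d (graded_part r I d)"
proof -
  have "mpoly.subspace (graded_part r I d)"
  proof (rule mpoly.subspaceI)
    show "0 \<in> graded_part r I d"
      using ideal mpoly.subspace_0[OF subspace_forms] by (simp add: in_graded_part ideal_in_def)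
    fix x assume x: "x \<in> graded_part r I d"
    show "x + y \<in> graded_part r I d" if "y \<in> graded_part r I d" for y
      using x that ideal mpoly.subspace_add[OF subspace_forms, of x r d y] by (simp add: in_graded_part ideal_in_def)
    show "smult c x \<in> graded_part r I d" for c
    proof -
      have "smult c 1 * x \<in> I"
        using x mpoly.subspace_scale[OF subspace_forms one_in_forms]
        by (intro mult_in_ideal) (auto simp: in_graded_part)
      then show ?thesis
        using x mpoly.subspace_scale[OF subspace_forms, of x r d c] by (simp add: in_graded_part flip: smult_mult_left)
    qed
  qed
  then show ?thesis
    by (auto simp: form_space_def in_graded_part)
qed

lemma hilb_eq_codim: "hilb r I d = codim r d (graded_part r I d)"
  by (simp add: hilb_def codim_def kdim_def)

lemma graded_part_Suc_e: "graded_part r I (Suc e) = forms r (Suc e)"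
proof (rule mpoly.finspan_subspace_eq[OF finspan_forms])
  show "mpoly.dim (forms r (Suc e) :: 'a mpoly set) \<le> mpoly.dim (graded_part r I (Suc e))"
    using hilb_Suc_e dim_add_codim[OF form_space_graded_part, of "Suc e"] by (simp add: hilb_eq_codim)
qed (use form_space_graded_part[of "Suc e"] in \<open>auto simp: form_space_def\<close>)

text \<open>\<open>I\<close> contains all forms of degree \<open>e + 1\<close>, so degree
  \<open>e\<close> of \<open>A\<close> is entirely socle. Its dimension 1 exhausts the
  socle.\<close>

lemma socle_trivial:
  assumes "d < e" "f \<in> forms r d" "\<And>j. j < r \<Longrightarrow> var j * f \<in> I"
  shows "f \<in> I"
proof -
  obtain N where N: "\<forall>d\<ge>N. hilb r I d = 0" "(\<Sum>d<N. socle_dim r I d) = 1"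
    using gorenstein unfolding artinian_gorenstein_def by blast
  have "e < N"
    using N(1) hilb_e by (metis not_less zero_neq_one)
  have "var j * f \<in> I" if "j < r" "f \<in> forms r e" for j f
    using forms_mult[OF var_in_forms[OF that(1)] that(2)] graded_part_Suc_e
    by (metis in_graded_part plus_1_eq_Suc)
  then have "{f \<in> forms r e. \<forall>j<r. var j * f \<in> I} = forms r e"
    by blast
  then have "socle_dim r I e = 1"
    using hilb_e by (simp add: socle_dim_def hilb_def)
  moreover have "(\<Sum>d\<in>{d, e}. socle_dim r I d) \<le> (\<Sum>d<N. socle_dim r I d)"
    using assms(1) \<open>e < N\<close> by (intro sum_mono2) auto
  ultimately have 0: "socle_dim r I d = 0"
    using N(2) assms(1) by simp
  define S where "S = {f \<in> forms r d. \<forall>j<r. var j * f \<in> I}"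
  have "graded_part r I d = S"
  proof (rule mpoly.finspan_subspace_eq)
    show "mpoly.finspan S"
      by (rule mpoly.finspan_subset[OF finspan_forms]) (auto simp: S_def)
    show "graded_part r I d \<subseteq> S"
      unfolding S_def using mult_in_ideal[OF var_in_forms] by (auto simp: in_graded_part)
    show "mpoly.dim S \<le> mpoly.dim (graded_part r I d)"
      using 0 by (simp add: socle_dim_def kdim_def S_def)
  qed (use form_space_graded_part in \<open>auto simp: form_space_def\<close>)
  then show ?thesis
    using assms(2,3) unfolding S_def by (auto simp: in_graded_part)
qed

text \<open>Induction on \<open>k\<close> moves one variable at a time from \<open>g\<close> to
  \<open>f\<close>; \<open>socle_trivial\<close> descends from all \<open>var j * f\<close> to
  \<open>f\<close>.\<close>

lemma pairing_nondegenerate: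
  assumes "d + k = e" "f \<in> forms r d" "\<And>g. g \<in> forms r k \<Longrightarrow> f * g \<in> I"
  shows "f \<in> I"
  using assms
proof (induction k arbitrary: d f)
  case 0
  then show ?case
    using one_in_forms by force
next
  case (Suc k)
  show ?case
  proof (rule socle_trivial)
    fix j assume j: "j < r"
    note v = var_in_forms[OF j, where 'a = 'a]
    show "var j * f \<in> I"
    proof (rule Suc.IH)
      show "var j * f \<in> forms r (Suc d)"
        using forms_mult[OF v Suc.prems(2)] by simp
      show "var j * f * g \<in> I" if "g \<in> forms r k" for g
        using forms_mult[OF v that] Suc.prems(3)[of "var j * g"] by (simp add: mult_ac)
    qed (use Suc.prems in simp)
  qed (use Suc.prems in auto)
qed

text \<open>\<open>z * x\<close> has degree \<open>e - k\<close>, so nondegeneracy against degree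
  \<open>k\<close> turns orthogonality into membership in \<open>I\<close>.\<close>

lemma perp_eq:
  assumes "a + i + k = e" "z \<in> forms r a"
  shows "{x \<in> forms r i. \<forall>y\<in>forms r k. z * (x * y) \<in> graded_part r I e} = {x \<in> forms r i. z * x \<in> I}"
proof (intro Collect_cong conj_cong refl iffI ballI)
  fix x :: "'a mpoly" assume x: "x \<in> forms r i"
  note zx = forms_mult[OF assms(2) x]
  { assume "\<forall>y\<in>forms r k. z * (x * y) \<in> graded_part r I e"
    then show "z * x \<in> I"
      using pairing_nondegenerate[OF assms(1) zx] by (simp add: in_graded_part mult.assoc) }
  fix y :: "'a mpoly" assume "z * x \<in> I" and y: "y \<in> forms r k"
  then show "z * (x * y) \<in> graded_part r I e"
    using mult_in_ideal[OF y, of "z * x"] forms_mult[OF zx y] assms(1) by (simp add: in_graded_part mult_ac)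
qed

text \<open>The codimensions are the ranks of multiplication by \<open>z\<close> on degrees
  \<open>i\<close> and \<open>k\<close> of \<open>A\<close>; the pairing into degree
  \<open>e\<close> makes these maps transposes of each other.\<close>

lemma codim_annihilator_le:
  assumes "a + i + k = e" "z \<in> forms r a"
  shows "codim r i {x \<in> forms r i. z * x \<in> I} \<le> codim r k {x \<in> forms r k. z * x \<in> I}"
proof -
  have "mpoly.dim (forms r i :: 'a mpoly set)
      + mpoly.dim {y \<in> forms r k. \<forall>x\<in>forms r i. z * (x * y) \<in> graded_part r I e}
    \<le> mpoly.dim (forms r k :: 'a mpoly set)
      + mpoly.dim {x \<in> forms r i. \<forall>y\<in>forms r k. z * (x * y) \<in> graded_part r I e}"
  proof (rule pairing_codim_le[where U = "forms r e"])
    \<comment> \<open>\<open>hilb_e\<close> makes degree \<open>e\<close> of \<open>I\<close> a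
      hyperplane.\<close>
    show "mpoly.dim (forms r e :: 'a mpoly set) \<le> Suc (mpoly.dim (graded_part r I e))"
      using hilb_e dim_add_codim[OF form_space_graded_part, of e] by (simp add: hilb_eq_codim)
    show "z * (x * y) \<in> forms r e" if "x \<in> forms r i" "y \<in> forms r k" for x y
      using forms_mult[OF assms(2) forms_mult[OF that]] assms(1) by (simp add: add.assoc)
  qed (use form_space_graded_part[of e] in \<open>auto simp: form_space_def subspace_forms finspan_forms\<close>)
  moreover have "{y \<in> forms r k. \<forall>x\<in>forms r i. z * (x * y) \<in> graded_part r I e}
      = {x \<in> forms r k. z * x \<in> I}"
    using perp_eq[of a k i z] assms by (simp add: mult.commute[of _ "_ :: 'a mpoly"] add_ac)
  ultimately have "mpoly.dim (forms r i :: 'a mpoly set) + mpoly.dim {x \<in> forms r k. z * x \<in> I}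
    \<le> mpoly.dim (forms r k :: 'a mpoly set) + mpoly.dim {x \<in> forms r i. z * x \<in> I}"
    unfolding perp_eq[OF assms] by simp
  then show ?thesis
    unfolding codim_def by linarith
qed

lemma codim_annihilator:
  assumes "a + i + k = e" "z \<in> forms r a"
  shows "codim r i {x \<in> forms r i. z * x \<in> I} = codim r k {x \<in> forms r k. z * x \<in> I}"
  using codim_annihilator_le[of a i k z] codim_annihilator_le[of a k i z] assms
  by (simp add: add_ac)

text \<open>The multiplier \<open>z = 1\<close>, of degree 0; \<open>z = L\<close> gives the next
  symmetry.\<close>

lemma hilb_symmetric: "i + k = e \<Longrightarrow> hilb r I i = hilb r I k"
  using codim_annihilator[OF _ one_in_forms, of i k]
  by (simp add: hilb_eq_codim in_graded_part[abs_def] graded_part_def Int_def conj_ac)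

lemma codim_colon_symmetric:
  assumes "Suc (i + k) = e" "L \<in> forms r 1"
  shows "codim r i (colon_space r i (graded_part r I (Suc i)) L)
    = codim r k (colon_space r k (graded_part r I (Suc k)) L)"
proof -
  have "colon_space r d (graded_part r I (Suc d)) L = {x \<in> forms r d. L * x \<in> I}" for d
    using forms_mult[OF assms(2), of _ d] by (auto simp: colon_space_def in_graded_part)
  then show ?thesis
    using codim_annihilator[of 1 i k L] assms by simp
qed

text \<open>The cuts behave like graded parts of the ideal generated by \<open>I\<close> and
  \<open>L\<close>, as \<open>macaulay_iter_codim\<close> requires.\<close>

lemma mult_in_cut_graded_part:
  assumes "L \<in> forms r 1" "M \<in> forms r 1" "x \<in> cut_space r d (graded_part r I (Suc d)) L"
  shows "M * x \<in> cut_space r (Suc d) (graded_part r I (Suc (Suc d))) L" (is "_ \<in> ?T")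
proof -
  have T: "mpoly.subspace ?T"
    unfolding cut_space_def by (rule mpoly.subspace_span)
  have "mpoly.subspace {x. M * x \<in> ?T}"
    using T by (auto simp: mpoly.subspace_def distrib_left simp flip: smult_mult_right)
  moreover have "M * x \<in> ?T" if "x \<in> graded_part r I (Suc d)" for x
    using that subset_cut[of "graded_part r I (Suc (Suc d))" r "Suc d" L]
      forms_mult[OF assms(2), of x "Suc d"] mult_in_ideal[OF assms(2), of x] by (auto simp: in_graded_part)
  moreover have "M * (L * y) \<in> ?T" if "y \<in> forms r d" for y
    using mult_in_cut[of "M * y" r "Suc d" L] forms_mult[OF assms(2) that] by (simp add: mult.left_commute)
  ultimately have "cut_space r d (graded_part r I (Suc d)) L \<subseteq> {x. M * x \<in> ?T}"
    unfolding cut_space_def[of r d] by (intro mpoly.span_minimal) auto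
  then show ?thesis
    using assms(3) by blast
qed

lemma hilb_growth:
  assumes inf: "infinite (UNIV :: 'a set)" and e: "e = Suc (2 * i + s)"
  shows "macaulay_shift (hilb r I i) (e - i) (- 1) (- 1)
      + macaulay_shift (hilb r I i) (e - i) (- int s) (- int (Suc s)) \<le> int (hilb r I (Suc i))"
proof -
  \<comment> \<open>Green's bound is used in degree \<open>e - i\<close>, which is
    \<open>Suc k\<close>.\<close>
  define k where "k = i + s"
  have k: "e - i = Suc k" "Suc (i + k) = e" "i + Suc k = e"
    using e by (simp_all add: k_def)
  note fs = form_space_graded_part
  obtain L where L: "L \<in> forms r 1" "codim r (Suc k) (cut_space r k (graded_part r I (Suc k)) L)
      \<le> green (Suc k) (hilb r I (Suc k))"
    using green_hyperplane_restriction[OF inf fs] unfolding hilb_eq_codim by blast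
  \<comment> \<open>The index is that of the source of \<open>L\<close>: \<open>c d\<close> measures
    \<open>A/LA\<close> in degree \<open>d + 1\<close>.\<close>
  define c where "c d = codim r (Suc d) (cut_space r d (graded_part r I (Suc d)) L)" for d
  define b where "b d = codim r d (colon_space r d (graded_part r I (Suc d)) L)" for d
  have h: "hilb r I (Suc d) = c d + b d" for d
    unfolding hilb_eq_codim c_def b_def by (rule codim_cut_colon[OF fs L(1)])
  have sym: "hilb r I i = hilb r I (Suc k)"
    using k(3) by (rule hilb_symmetric)
  have "b i = b k"
    unfolding b_def using k(2) L(1) by (rule codim_colon_symmetric)
  have "macaulay_iter (Suc i + s) s (c (i + s)) \<le> c i"
  proof -
    have "form_space r j (cut_space r (j - 1) (graded_part r I j) L)" if "Suc i \<le> j" for j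
      using that form_space_cut[OF fs L(1), of "j - 1"] by simp
    moreover have "M * x \<in> cut_space r (Suc j - 1) (graded_part r I (Suc j)) L"
      if "Suc i \<le> j" "M \<in> forms r 1" "x \<in> cut_space r (j - 1) (graded_part r I j) L" for j M x
      using that mult_in_cut_graded_part[OF L(1), of M x "j - 1"] by simp
    ultimately show ?thesis
      using macaulay_iter_codim[OF inf, of "Suc i" r "\<lambda>j. cut_space r (j - 1) (graded_part r I j) L" s]
      by (simp add: c_def)
  qed
  moreover have "macaulay_shift (hilb r I i) (Suc k) (- 1) (- 1)
      + macaulay_shift (hilb r I i) (Suc k) (- int s) (- int (Suc s))
      \<le> int (hilb r I i - c k) + int (macaulay_iter (Suc k) s (c k))"
    using L(2) by (intro macaulay_shift_bound) (simp_all add: c_def sym)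
  \<comment> \<open>\<open>hilb r I i - c k\<close> is \<open>b k = b i\<close>, and adding
    \<open>c i\<close> gives \<open>hilb r I (Suc i)\<close>.\<close>
  ultimately show ?thesis
    using h[of i] h[of k] sym \<open>b i = b k\<close> by (simp add: k(1)) (simp add: k_def)
qed

end

theorem theorem2p4:
  fixes I :: "'a::field mpoly set" and r e i :: nat
  assumes "infinite (UNIV :: 'a set)"
    and "homogeneous_ideal r I"
    and "artinian_gorenstein r I"
    and "hilb r I 0 = 1" and "hilb r I 1 = r"
    and "hilb r I (e - 1) = r" and "hilb r I e = 1"
    and "\<forall>d>e. hilb r I d = 0"
    and "1 \<le> i" and "2 * int i \<le> int e - 2"
  shows "int (hilb r I (i + 1)) \<ge>
           macaulay_shift (hilb r I i) (e - i) (-1) (-1)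
         + macaulay_shift (hilb r I i) (e - i) (-(int e - 2 * int i - 1)) (-(int e - 2 * int i))"
proof -
  interpret gorenstein_ideal r e I
    using assms by unfold_locales (auto simp: homogeneous_ideal_def)
  \<comment> \<open>The number of Macaulay steps from degree \<open>e - i\<close> down to
    \<open>i + 1\<close>.\<close>
  define s where "s = e - 2 * i - 1"
  have e: "e = Suc (2 * i + s)"
    using assms(10) by (simp add: s_def)
  have shift: "- (int e - 2 * int i - 1) = - int s" "- (int e - 2 * int i) = - int (Suc s)"
    using e by simp_all
  show ?thesis
    unfolding shift using hilb_growth[OF assms(1) e] by simp
qed

end
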